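(* Let $n,k\geq 1$ be integers and let $r\in\{1,2,3,\dots\}\cup\{\infty\}$. Let $\pi^n_k\colon F(\mathbb{R}^n,k)\to B(\mathbb{R}^n,k)$ be the quotient map, and let $B(\mathbb{R}^n,k)\hookrightarrow B(\mathbb{R}^{n+r},k)$ be the map induced by the standard inclusion $\mathbb{R}^n\cong\mathbb{R}^n\times\{0\}\subset\mathbb{R}^{n+r}$. Then $$\mathrm{secat}(\pi^n_k)=\mathrm{cat}\big(B(\mathbb{R}^n,k)\hookrightarrow B(\mathbb{R}^{n+r},k)\big)=\mathrm{cat}_{B(\mathbb{R}^{n+r},k)}B(\mathbb{R}^n,k).$$
   Context: For a space $M$, the ordered configuration space is $F(M,k)=\{(x_1,\dots,x_k)\in M^k : x_i\neq x_j \text{ for } i\neq j\}$, and the unordered configuration space is $B(M,k)=F(M,k)/\Sigma_k$, the quotient by the free permuting action of the symmetric group $\Sigma_k$; $\pi^n_k\colon F(\mathbb{R}^n,k)\to B(\mathbb{R}^n,k)$ is the quotient covering. $\mathbb{R}^\infty=\bigcup_n\mathbb{R}^n$ with the colimit topology, and $F(\mathbb{R}^\infty,k)$, $B(\mathbb{R}^\infty,k)$ are the corresponding colimits. The sectional category $\mathrm{secat}(p)$ of a fibration $p\colon E\to B$ is the least integer $m$ such that $B$ can be covered by $m+1$ open sets each admitting a local section of $p$. The category $\mathrm{cat}(f)$ of a map $f\colon A\to B$ is the least integer $m$ such that $A$ can be covered by $m+1$ open sets on each of which the restriction of $f$ is nullhomotopic. For $A\subset B$, the subspace category $\mathrm{cat}_B(A)$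 is the least $m$ such that $A$ can be covered by $m+1$ subsets of $B$, each open in $B$ and contractible in $B$ (i.e., its inclusion into $B$ is nullhomotopic). *)

theory Defs
  imports "HOL-Analysis.Analysis" "HOL-Library.Extended_Nat"
begin

definition quotient_top :: "'a topology \<Rightarrow> ('a \<Rightarrow> 'b) \<Rightarrow> 'b topology" where
  "quotient_top X f = topology (\<lambda>U. U \<subseteq> f ` topspace X \<and> openin X {x \<in> topspace X. f x \<in> U})"

lemma istopology_quotient_top:
  "istopology (\<lambda>U. U \<subseteq> f ` topspace X \<and> openin X {x \<in> topspace X. f x \<in> U})"
proof -
  have 1: "openin X {x \<in> topspace X. f x \<in> S \<inter> T}"
    if "openin X {x \<in> topspace X. f x \<in> S}" "openin X {x \<in> topspace X. f x \<in> T}" for S T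
  proof -
    have "{x \<in> topspace X. f x \<in> S \<inter> T} = {x \<in> topspace X. f x \<in> S} \<inter> {x \<in> topspace X. f x \<in> T}"
      by auto
    then show ?thesis using that by auto
  qed
  have 2: "openin X {x \<in> topspace X. f x \<in> \<Union>K}"
    if "\<forall>S\<in>K. openin X {x \<in> topspace X. f x \<in> S}" for K
  proof -
    have "{x \<in> topspace X. f x \<in> \<Union>K} = (\<Union>S\<in>K. {x \<in> topspace X. f x \<in> S})" by auto
    moreover have "openin X (\<Union>S\<in>K. {x \<in> topspace X. f x \<in> S})"
      using that by (intro openin_Union) auto
    ultimately show ?thesis by simp
  qed
  show ?thesis unfolding istopology_def
  proof (intro conjI allI impI)
    fix S T assume S: "S \<subseteq> f ` topspace X \<and> openin X {x \<in> topspace X. f x \<in> S}"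
      and T: "T \<subseteq> f ` topspace X \<and> openin X {x \<in> topspace X. f x \<in> T}"
    show "S \<inter> T \<subseteq> f ` topspace X" using S by blast
    show "openin X {x \<in> topspace X. f x \<in> S \<inter> T}" using S T 1 by blast
  next
    fix K assume K: "\<forall>S\<in>K. S \<subseteq> f ` topspace X \<and> openin X {x \<in> topspace X. f x \<in> S}"
    show "\<Union>K \<subseteq> f ` topspace X" using K by blast
    show "openin X {x \<in> topspace X. f x \<in> \<Union>K}" using K 2 by blast
  qed
qed

definition colim_top :: "(nat \<Rightarrow> 'a topology) \<Rightarrow> 'a topology" where
  "colim_top X = topology (\<lambda>U. U \<subseteq> (\<Union>m. topspace (X m)) \<and> (\<forall>m. openin (X m) (U \<inter> topspace (X m))))"

lemma istopology_colim_top: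
  "istopology (\<lambda>U. U \<subseteq> (\<Union>m. topspace (X m)) \<and> (\<forall>m. openin (X m) (U \<inter> topspace (X m))))"
proof -
  have 1: "openin (X m) ((S \<inter> T) \<inter> topspace (X m))"
    if "openin (X m) (S \<inter> topspace (X m))" "openin (X m) (T \<inter> topspace (X m))" for S T m
  proof -
    have "(S \<inter> T) \<inter> topspace (X m) = (S \<inter> topspace (X m)) \<inter> (T \<inter> topspace (X m))" by auto
    then show ?thesis using that by auto
  qed
  have 2: "openin (X m) (\<Union>K \<inter> topspace (X m))"
    if "\<forall>S\<in>K. openin (X m) (S \<inter> topspace (X m))" for K m
  proof -
    have "\<Union>K \<inter> topspace (X m) = (\<Union>S\<in>K. S \<inter> topspace (X m))" by auto
    moreover have "openin (X m) (\<Union>S\<in>K. S \<inter> topspace (X m))"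
      using that by (intro openin_Union) auto
    ultimately show ?thesis by simp
  qed
  show ?thesis unfolding istopology_def
  proof (intro conjI allI impI)
    fix S T assume S: "S \<subseteq> (\<Union>m. topspace (X m)) \<and> (\<forall>m. openin (X m) (S \<inter> topspace (X m)))"
      and T: "T \<subseteq> (\<Union>m. topspace (X m)) \<and> (\<forall>m. openin (X m) (T \<inter> topspace (X m)))"
    show "S \<inter> T \<subseteq> (\<Union>m. topspace (X m))" using S by blast
    show "openin (X m) (S \<inter> T \<inter> topspace (X m))" for m using S T 1 by blast
  next
    fix K assume K: "\<forall>S\<in>K. S \<subseteq> (\<Union>m. topspace (X m)) \<and> (\<forall>m. openin (X m) (S \<inter> topspace (X m)))"
    show "\<Union>K \<subseteq> (\<Union>m. topspace (X m))" using K by blast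
    show "openin (X m) (\<Union>K \<inter> topspace (X m))" for m using K 2 by blast
  qed
qed

text \<open>\<open>\<real>\<^sup>n\<close> is realised as the set of real sequences vanishing from index \<open>n\<close> on,
  with the subspace topology of the product topology (which is the Euclidean topology).
  Thus \<open>\<real>\<^sup>n \<cong> \<real>\<^sup>n \<times> {0} \<subseteq> \<real>\<^sup>n\<^sup>+\<^sup>r\<close> is literally an inclusion of sets.\<close>

definition Rn_set :: "nat \<Rightarrow> (nat \<Rightarrow> real) set" where
  "Rn_set n = {x. \<forall>i\<ge>n. x i = 0}"

definition Rn :: "nat \<Rightarrow> (nat \<Rightarrow> real) topology" where
  "Rn n = subtopology (product_topology (\<lambda>_. euclideanreal) UNIV) (Rn_set n)"

definition Fconf :: "'a topology \<Rightarrow> nat \<Rightarrow> (nat \<Rightarrow> 'a) topology" where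
  "Fconf M k = subtopology (product_topology (\<lambda>_. M) {..<k}) {f. inj_on f {..<k}}"

text \<open>The quotient by the permutation action of \<open>\<Sigma>\<^sub>k\<close>: a tuple is identified with its
  (k-element) set of entries; two tuples have the same image iff they differ by a permutation.\<close>

definition conf_quot :: "nat \<Rightarrow> (nat \<Rightarrow> 'a) \<Rightarrow> 'a set" where
  "conf_quot k f = f ` {..<k}"

definition Bconf :: "'a topology \<Rightarrow> nat \<Rightarrow> 'a set topology" where
  "Bconf M k = quotient_top (Fconf M k) (conf_quot k)"

definition Binf :: "nat \<Rightarrow> (nat \<Rightarrow> real) set topology" where
  "Binf k = colim_top (\<lambda>m. Bconf (Rn m) k)"

definition Btarget :: "nat \<Rightarrow> enat \<Rightarrow> nat \<Rightarrow> (nat \<Rightarrow> real) set topology" where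
  "Btarget n r k = (case r of enat m \<Rightarrow> Bconf (Rn (n + m)) k | \<infinity> \<Rightarrow> Binf k)"

definition secat :: "'e topology \<Rightarrow> 'b topology \<Rightarrow> ('e \<Rightarrow> 'b) \<Rightarrow> enat" where
  "secat E B p = (INF m \<in> {m::nat. \<exists>U :: nat \<Rightarrow> 'b set.
        (\<forall>i\<le>m. openin B (U i) \<and>
           (\<exists>s. continuous_map (subtopology B (U i)) E s \<and> (\<forall>x\<in>U i. p (s x) = x)))
        \<and> topspace B \<subseteq> (\<Union>i\<le>m. U i)}. enat m)"

definition cat_map :: "'a topology \<Rightarrow> 'b topology \<Rightarrow> ('a \<Rightarrow> 'b) \<Rightarrow> enat" where
  "cat_map A B f = (INF m \<in> {m::nat. \<exists>U :: nat \<Rightarrow> 'a set.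
        (\<forall>i\<le>m. openin A (U i) \<and>
           (\<exists>c. homotopic_with (\<lambda>_. True) (subtopology A (U i)) B f (\<lambda>_. c)))
        \<and> topspace A \<subseteq> (\<Union>i\<le>m. U i)}. enat m)"

definition subspace_cat :: "'b topology \<Rightarrow> 'b set \<Rightarrow> enat" where
  "subspace_cat B A = (INF m \<in> {m::nat. \<exists>U :: nat \<Rightarrow> 'b set.
        (\<forall>i\<le>m. openin B (U i) \<and>
           (\<exists>c. homotopic_with (\<lambda>_. True) (subtopology B (U i)) B id (\<lambda>_. c)))
        \<and> A \<subseteq> (\<Union>i\<le>m. U i)}. enat m)"

end

theory Submission
  imports Defs
begin

text \<open>A nullhomotopy in \<open>B(\<real>\<^sup>n\<^sup>+\<^sup>r, k)\<close> of the inclusion of an open \<open>U \<subseteq> B(\<real>\<^sup>n, k)\<close>, run backwards, is a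
  homotopy from a constant map; lifting it to ordered configurations ends in an ordering of the
  points of each \<open>S \<in> U\<close>, i.e. a section over \<open>U\<close>. To avoid distinguishing finite \<open>r\<close> from \<open>r = \<infinity>\<close>,
  the lifting takes place over \<open>B(\<real>\<^sup>\<nat>, k)\<close> with the product topology, into which all the targets map
  continuously.

  Conversely, a section over \<open>U\<close> also orders all configurations in \<open>\<real>\<^sup>n\<^sup>+\<^sup>r\<close> whose projection to
  \<open>\<real>\<^sup>n\<close> is injective with image in \<open>U\<close>. They form an open set containing \<open>U\<close>, and it is contracted by
  moving the \<open>i\<close>-th point \<open>x\<^sub>i\<close> first to \<open>(x\<^sub>i, i)\<close> and then to \<open>(0, i)\<close>, using one extra dimension.\<close>

section \<open>Quotient and colimit topologies\<close>

lemma openin_quotient_top: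
  "openin (quotient_top X f) U \<longleftrightarrow> U \<subseteq> f ` topspace X \<and> openin X {x \<in> topspace X. f x \<in> U}"
  unfolding quotient_top_def by (simp add: topology_inverse' istopology_quotient_top)

lemma topspace_quotient_top: "topspace (quotient_top X f) = f ` topspace X"
proof
  show "topspace (quotient_top X f) \<subseteq> f ` topspace X"
    using openin_quotient_top[of X f "topspace (quotient_top X f)"] by auto
  have "{x \<in> topspace X. f x \<in> f ` topspace X} = topspace X"
    by auto
  then show "f ` topspace X \<subseteq> topspace (quotient_top X f)"
    by (intro openin_subset) (simp add: openin_quotient_top)
qed

lemma quotient_map_quotient_top: "quotient_map X (quotient_top X f) f"
  unfolding quotient_map_def by (auto simp: topspace_quotient_top openin_quotient_top)

lemma openin_colim_top:
  "openin (colim_top X) U \<longleftrightarrow>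
     U \<subseteq> (\<Union>m. topspace (X m)) \<and> (\<forall>m. openin (X m) (U \<inter> topspace (X m)))"
  unfolding colim_top_def by (simp add: topology_inverse' istopology_colim_top)

lemma topspace_colim_top: "topspace (colim_top X) = (\<Union>m. topspace (X m))"
proof
  show "topspace (colim_top X) \<subseteq> (\<Union>m. topspace (X m))"
    using openin_colim_top[of X "topspace (colim_top X)"] by auto
  have "(\<Union>m. topspace (X m)) \<inter> topspace (X m') = topspace (X m')" for m'
    by auto
  then show "(\<Union>m. topspace (X m)) \<subseteq> topspace (colim_top X)"
    by (intro openin_subset) (simp add: openin_colim_top)
qed

lemma continuous_map_into_colim_top: "continuous_map (X m) (colim_top X) id"
proof -
  have "{x \<in> topspace (X m). x \<in> U} = U \<inter> topspace (X m)" for U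
    by auto
  then show ?thesis
    by (auto simp: continuous_map topspace_colim_top openin_colim_top)
qed

lemma continuous_map_from_colim_top:
  assumes "\<And>m. continuous_map (X m) Y f"
  shows "continuous_map (colim_top X) Y f"
proof -
  have "{x \<in> topspace (colim_top X). f x \<in> U} \<inter> topspace (X m)
      = {x \<in> topspace (X m). f x \<in> U}" for U m
    by (auto simp: topspace_colim_top)
  then show ?thesis
    using assms by (fastforce simp: continuous_map topspace_colim_top openin_colim_top)
qed

text \<open>Taking the product with \<open>Z\<close> commutes with the colimit because points of \<open>Z\<close> have small
  compact neighbourhoods, to which the tube lemma applies at every stage.\<close>

lemma continuous_map_prod_colim_top:
  assumes Z: "neighbourhood_base_of (compactin Z) Z"
    and U: "openin (colim_top X) U"
    and f: "\<And>m. continuous_map (prod_topology Z (subtopology (X m) U)) Y f"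
  shows "continuous_map (prod_topology Z (subtopology (colim_top X) U)) Y f"
  unfolding continuous_map
proof (intro conjI allI impI)
  have Usub: "U \<subseteq> (\<Union>m. topspace (X m))" and Uop: "\<And>m. openin (X m) (U \<inter> topspace (X m))"
    using U by (auto simp: openin_colim_top)
  have top: "topspace (subtopology (colim_top X) U) = U"
    using Usub by (auto simp: topspace_colim_top)
  show "f ` topspace (prod_topology Z (subtopology (colim_top X) U)) \<subseteq> topspace Y"
  proof clarify
    fix t u assume "(t,u) \<in> topspace (prod_topology Z (subtopology (colim_top X) U))"
    then have "t \<in> topspace Z" "u \<in> U"
      by (auto simp: top)
    moreover from this obtain m where "u \<in> topspace (X m)"
      using Usub by auto
    ultimately show "f (t,u) \<in> topspace Y"
      using f[of m] by (force simp: continuous_map)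
  qed
  fix Q assume Q: "openin Y Q"
  show "openin (prod_topology Z (subtopology (colim_top X) U))
          {x \<in> topspace (prod_topology Z (subtopology (colim_top X) U)). f x \<in> Q}"
    unfolding openin_prod_topology_alt
  proof (intro allI impI)
    fix t u
    assume "(t,u) \<in> {x \<in> topspace (prod_topology Z (subtopology (colim_top X) U)). f x \<in> Q}"
    then have t: "t \<in> topspace Z" and u: "u \<in> U" and fQ: "f (t,u) \<in> Q"
      by (auto simp: top)
    have stage: "openin (prod_topology Z (subtopology (X m) U))
        {x \<in> topspace (prod_topology Z (subtopology (X m) U)). f x \<in> Q}" for m
      by (rule openin_continuous_map_preimage[OF f Q])
    obtain m where m: "u \<in> topspace (X m)"
      using Usub u by auto
    \<comment> \<open>For fixed \<open>u\<close>, continuity of \<open>t \<mapsto> f (t,u)\<close>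
      can be read off at a single stage \<open>m\<close> containing \<open>u\<close>. This produces
      the compact neighbourhood \<open>C\<close> of \<open>t\<close>.\<close>
    have "continuous_map Z (prod_topology Z (subtopology (X m) U)) (\<lambda>t. (t,u))"
      using u m by (auto simp: continuous_map_pairwise o_def)
    from continuous_map_compose[OF this f] have "continuous_map Z Y (\<lambda>t. f (t,u))"
      by (simp add: o_def)
    then have "openin Z {t \<in> topspace Z. f (t,u) \<in> Q}"
      using Q by (rule openin_continuous_map_preimage)
    then obtain A C where A: "openin Z A" and C: "compactin Z C" and "t \<in> A" "A \<subseteq> C"
      and CQ: "C \<subseteq> {t \<in> topspace Z. f (t,u) \<in> Q}"
      using Z t fQ unfolding neighbourhood_base_of by (metis (no_types, lifting) mem_Collect_eq)
    \<comment> \<open>The points whose whole slice \<open>C \<times> {u'}\<close> is sent into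
      \<open>Q\<close>. As \<open>C\<close> is the same for all stages, the tube lemma at each stage
      shows that \<open>D\<close> is open in the colimit.\<close>
    define D where "D = {u' \<in> U. \<forall>t'\<in>C. f (t',u') \<in> Q}"
    have "openin (X m) (D \<inter> topspace (X m))" for m
    proof (subst openin_subopen, intro ballI)
      fix v assume v: "v \<in> D \<inter> topspace (X m)"
      then have Cv: "C \<times> {v} \<subseteq> {x \<in> topspace (prod_topology Z (subtopology (X m) U)). f x \<in> Q}"
        using CQ by (auto simp: D_def)
      have vU: "v \<in> topspace (subtopology (X m) U)"
        using v by (auto simp: D_def)
      obtain A' V where "openin (subtopology (X m) U) V" "C \<subseteq> A'" "v \<in> V"
        and sub: "A' \<times> V \<subseteq> {x \<in> topspace (prod_topology Z (subtopology (X m) U)). f x \<in> Q}"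
        using tube_lemma_left[OF stage[of m] C vU Cv] by (elim exE conjE) (rule that)
      have V: "V \<subseteq> U \<inter> topspace (X m)"
        using openin_subset[OF \<open>openin (subtopology (X m) U) V\<close>] by auto
      have "openin (X m) V"
        using \<open>openin (subtopology (X m) U) V\<close> openin_open_subtopology[OF Uop[of m], of V]
          subtopology_restrict[of "X m" U] by (simp add: Int_commute)
      moreover have "V \<subseteq> D \<inter> topspace (X m)"
        using V sub \<open>C \<subseteq> A'\<close> by (auto simp: D_def)
      ultimately show "\<exists>T. openin (X m) T \<and> v \<in> T \<and> T \<subseteq> D \<inter> topspace (X m)"
        using \<open>v \<in> V\<close> by blast
    qed
    then have "openin (colim_top X) D"
      using Usub by (auto simp: openin_colim_top D_def)
    then have "openin (subtopology (colim_top X) U) D"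
      by (auto simp: openin_subtopology D_def)
    moreover have "u \<in> D"
      using u CQ by (auto simp: D_def)
    moreover have "A \<times> D \<subseteq> {x \<in> topspace (prod_topology Z (subtopology (colim_top X) U)). f x \<in> Q}"
      using \<open>A \<subseteq> C\<close> CQ by (auto simp: D_def top topspace_colim_top dest: subsetD[OF Usub])
    ultimately show "\<exists>A' V. openin Z A' \<and> openin (subtopology (colim_top X) U) V \<and> t \<in> A' \<and> u \<in> V
        \<and> A' \<times> V \<subseteq> {x \<in> topspace (prod_topology Z (subtopology (colim_top X) U)). f x \<in> Q}"
      using A \<open>t \<in> A\<close> by blast
  qed
qed

section \<open>Configuration spaces\<close>

lemma topspace_Fconf:
  "topspace (Fconf M k) = {f \<in> {..<k} \<rightarrow>\<^sub>E topspace M. inj_on f {..<k}}"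
  by (auto simp: Fconf_def)

lemma continuous_map_into_Fconf:
  "continuous_map X (Fconf M k) g \<longleftrightarrow>
     g \<in> topspace X \<rightarrow> topspace (Fconf M k) \<and> (\<forall>i<k. continuous_map X M (\<lambda>x. g x i))"
  unfolding Fconf_def continuous_map_in_subtopology continuous_map_componentwise
  by (auto simp: PiE_def Pi_iff image_subset_iff dest: continuous_map_funspace)

lemma continuous_map_Fconf_component:
  "i < k \<Longrightarrow> continuous_map (Fconf M k) M (\<lambda>f. f i)"
  using continuous_map_into_Fconf[of "Fconf M k" M k "\<lambda>f. f"] by simp

lemma quotient_map_conf_quot: "quotient_map (Fconf M k) (Bconf M k) (conf_quot k)"
  unfolding Bconf_def by (rule quotient_map_quotient_top)

lemma conf_quot_restrict [simp]: "conf_quot k (restrict f {..<k}) = f ` {..<k}"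
  by (auto simp: conf_quot_def)

text \<open>Any enumeration of a \<open>k\<close>-element set, cut down to an extensional function,
  is an ordered configuration above it.\<close>

lemma topspace_Bconf:
  "topspace (Bconf M k) = {S. S \<subseteq> topspace M \<and> finite S \<and> card S = k}"
proof -
  have "S \<in> conf_quot k ` topspace (Fconf M k)" if S: "S \<subseteq> topspace M" "finite S" "card S = k" for S
  proof -
    obtain f where f: "bij_betw f {..<k} S"
      using S(2,3) by (metis ex_bij_betw_nat_finite atLeast0LessThan)
    then have "restrict f {..<k} \<in> topspace (Fconf M k)"
      using S(1) by (auto simp: topspace_Fconf bij_betw_def)
    moreover have "conf_quot k (restrict f {..<k}) = S"
      using f by (simp add: bij_betw_def)
    ultimately show ?thesis
      by blast
  qed
  then show ?thesis
    unfolding Bconf_def topspace_quotient_top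
    by (auto simp: topspace_Fconf conf_quot_def card_image)
qed

lemma openin_Bconf_iff:
  "openin (Bconf M k) U \<longleftrightarrow>
     U \<subseteq> topspace (Bconf M k) \<and> openin (Fconf M k) {f \<in> topspace (Fconf M k). conf_quot k f \<in> U}"
  using quotient_map_conf_quot[of M k] openin_subset[of "Bconf M k" U]
  unfolding quotient_map_def by blast

text \<open>Upstairs the condition says that \<open>f i\<close> lies in \<open>Q\<close> for some
  label \<open>i\<close>, a union of open conditions. These hit sets supply the open sets of
  \<open>Bconf\<close> in the local lifting argument.\<close>

lemma openin_Bconf_meet:
  assumes "openin M Q"
  shows "openin (Bconf M k) {S \<in> topspace (Bconf M k). S \<inter> Q \<noteq> {}}"
proof -
  have "{f \<in> topspace (Fconf M k). conf_quot k f \<in> {S \<in> topspace (Bconf M k). S \<inter> Q \<noteq> {}}}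
      = (\<Union>i<k. {f \<in> topspace (Fconf M k). f i \<in> Q})"
    using quotient_imp_continuous_map[OF quotient_map_conf_quot[of M k]]
    by (auto simp: continuous_map conf_quot_def)
  moreover have "openin (Fconf M k) {f \<in> topspace (Fconf M k). f i \<in> Q}" if "i < k" for i
    using openin_continuous_map_preimage[OF continuous_map_Fconf_component[OF that] assms] .
  ultimately show ?thesis
    by (auto simp: openin_Bconf_iff intro!: openin_Union)
qed

text \<open>On ordered tuples the map is composition with \<open>\<phi>\<close> in each component.
  Over an open \<open>W\<close> the quotient map restricts to a quotient map, so continuity
  descends; injectivity keeps the \<open>k\<close> points distinct.\<close>

lemma continuous_map_Bconf_image:
  assumes \<phi>: "continuous_map M N \<phi>"
    and W: "openin (Bconf M k) W" and inj: "\<And>S. S \<in> W \<Longrightarrow> inj_on \<phi> S"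
  shows "continuous_map (subtopology (Bconf M k) W) (Bconf N k) ((`) \<phi>)"
proof -
  define V where "V = {f \<in> topspace (Fconf M k). conf_quot k f \<in> W}"
  have q: "quotient_map (subtopology (Fconf M k) V) (subtopology (Bconf M k) W) (conf_quot k)"
    using quotient_map_restriction[OF quotient_map_conf_quot V_def[symmetric]] W by blast
  \<comment> \<open>Points of \<open>Fconf\<close> are extensional functions on
    \<open>{..<k}\<close>, whence \<open>restrict\<close> here and in later constructions of
    tuples.\<close>
  have "restrict (\<phi> \<circ> f) {..<k} \<in> topspace (Fconf N k)" if f: "f \<in> V" for f
  proof -
    have "f \<in> {..<k} \<rightarrow>\<^sub>E topspace M" "inj_on f {..<k}" "inj_on \<phi> (f ` {..<k})"
      using f inj by (auto simp: V_def topspace_Fconf conf_quot_def)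
    moreover have "\<phi> ` topspace M \<subseteq> topspace N"
      using \<phi> by (simp add: continuous_map)
    ultimately show ?thesis
      by (auto simp: topspace_Fconf inj_on_def PiE_iff image_subset_iff)
  qed
  moreover have "continuous_map (subtopology (Fconf M k) V) N (\<lambda>f. \<phi> (f i))" if "i < k" for i
    using continuous_map_compose[OF continuous_map_Fconf_component[OF that] \<phi>]
    by (simp add: o_def continuous_map_from_subtopology)
  ultimately have "continuous_map (subtopology (Fconf M k) V) (Fconf N k) (\<lambda>f. restrict (\<phi> \<circ> f) {..<k})"
    by (auto simp: continuous_map_into_Fconf)
  from continuous_map_compose[OF this quotient_imp_continuous_map[OF quotient_map_conf_quot]]
  have "continuous_map (subtopology (Fconf M k) V) (Bconf N k) ((`) \<phi> \<circ> conf_quot k)"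
    by (simp add: o_def conf_quot_def image_image)
  then show ?thesis
    using continuous_compose_quotient_map[OF q] by blast
qed

lemma continuous_map_Bconf_subtopology:
  assumes "A \<subseteq> B"
  shows "continuous_map (Bconf (subtopology Y A) k) (Bconf (subtopology Y B) k) id"
proof -
  have "continuous_map (subtopology Y A) (subtopology Y B) id"
    using assms by (auto simp: continuous_map_in_subtopology continuous_map_from_subtopology)
  from continuous_map_Bconf_image[OF this openin_topspace, of k]
  show ?thesis
    by (simp add: image_id id_def[symmetric])
qed

text \<open>Upstairs, injectivity excludes finitely many coincidences
  \<open>\<phi> (f i) = \<phi> (f j)\<close>, each of which is closed because \<open>N\<close> is
  Hausdorff.\<close>

lemma openin_Bconf_inj_on:
  assumes N: "Hausdorff_space N" and \<phi>: "continuous_map M N \<phi>"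
  shows "openin (Bconf M k) {S \<in> topspace (Bconf M k). inj_on \<phi> S}"
proof -
  define E where "E i j = topspace (Fconf M k) - {f \<in> topspace (Fconf M k). \<phi> (f i) = \<phi> (f j)}" for i j
  have "openin (Fconf M k) (E i j)" if "i < k" "j < k" for i j
    unfolding E_def
    using continuous_map_compose[OF continuous_map_Fconf_component[OF that(1)] \<phi>]
      continuous_map_compose[OF continuous_map_Fconf_component[OF that(2)] \<phi>]
    by (intro openin_diff openin_topspace closedin_continuous_maps_eq[OF N]) (auto simp: o_def)
  \<comment> \<open>Inserting the whole space keeps the family nonempty when there are no pairs
    \<open>i \<noteq> j\<close>, that is for \<open>k \<le> 1\<close>.\<close>
  then have "openin (Fconf M k) (\<Inter>(insert (topspace (Fconf M k))
      ((\<lambda>(i,j). E i j) ` {(i,j). i < k \<and> j < k \<and> i \<noteq> j})))"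
  proof (intro openin_Inter)
    have "finite ({..<k} \<times> {..<k})" by simp
    then show "finite (insert (topspace (Fconf M k)) ((\<lambda>(i,j). E i j) ` {(i,j). i < k \<and> j < k \<and> i \<noteq> j}))"
      by (intro finite.insertI finite_imageI) (erule rev_finite_subset, auto)
  qed auto
  moreover have "\<Inter>(insert (topspace (Fconf M k)) ((\<lambda>(i,j). E i j) ` {(i,j). i < k \<and> j < k \<and> i \<noteq> j}))
      = {f \<in> topspace (Fconf M k). conf_quot k f \<in> {S \<in> topspace (Bconf M k). inj_on \<phi> S}}"
    (is "?L = ?R")
  proof -
    have "f \<in> ?L \<longleftrightarrow> f \<in> ?R" for f
    proof (cases "f \<in> topspace (Fconf M k)")
      case True
      then have "conf_quot k f \<in> topspace (Bconf M k)" "inj_on f {..<k}"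
        using quotient_imp_continuous_map[OF quotient_map_conf_quot[of M k]]
        by (auto simp: continuous_map topspace_Fconf)
      then have "f \<in> ?R \<longleftrightarrow> (\<forall>i<k. \<forall>j<k. i \<noteq> j \<longrightarrow> \<phi> (f i) \<noteq> \<phi> (f j))"
        using True by (auto simp: conf_quot_def inj_on_def)
      then show ?thesis
        using True by (auto simp: E_def)
    qed auto
    then show ?thesis by blast
  qed
  ultimately show ?thesis
    by (auto simp: openin_Bconf_iff)
qed

section \<open>Lifting homotopies from unordered to ordered configurations\<close>

text \<open>Path lifting for the covering of unordered by ordered configurations:
  \<open>\<gamma>\<close> orders the points of \<open>p t\<close> continuously in \<open>t\<close>.
  Only the two end orderings are exposed, so that transports can be composed as a relation.\<close>

definition conf_transport ::
    "nat \<Rightarrow> (real \<Rightarrow> 'a::topological_space set) \<Rightarrow> real \<Rightarrow> real \<Rightarrow> (nat \<Rightarrow> 'a) \<Rightarrow> (nat \<Rightarrow> 'a) \<Rightarrow> bool" where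
  "conf_transport k p a b f f' \<longleftrightarrow>
     (\<exists>\<gamma>. (\<forall>i<k. continuous_on {a..b} (\<lambda>t. \<gamma> t i)) \<and>
          (\<forall>t\<in>{a..b}. inj_on (\<gamma> t) {..<k} \<and> \<gamma> t ` {..<k} = p t) \<and>
          (\<forall>i<k. \<gamma> a i = f i \<and> \<gamma> b i = f' i))"

lemma conf_transport_trans:
  assumes "conf_transport k p a b f f'" "conf_transport k p b c f' f''" "a \<le> b" "b \<le> c"
  shows "conf_transport k p a c f f''"
proof -
  obtain \<gamma> where \<gamma>: "\<And>i. i<k \<Longrightarrow> continuous_on {a..b} (\<lambda>t. \<gamma> t i)"
      "\<And>t. t\<in>{a..b} \<Longrightarrow> inj_on (\<gamma> t) {..<k} \<and> \<gamma> t ` {..<k} = p t"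
      "\<And>i. i<k \<Longrightarrow> \<gamma> a i = f i \<and> \<gamma> b i = f' i"
    using assms(1) unfolding conf_transport_def by blast
  obtain \<delta> where \<delta>: "\<And>i. i<k \<Longrightarrow> continuous_on {b..c} (\<lambda>t. \<delta> t i)"
      "\<And>t. t\<in>{b..c} \<Longrightarrow> inj_on (\<delta> t) {..<k} \<and> \<delta> t ` {..<k} = p t"
      "\<And>i. i<k \<Longrightarrow> \<delta> b i = f' i \<and> \<delta> c i = f'' i"
    using assms(2) unfolding conf_transport_def by blast
  define \<eta> where "\<eta> t = (if t \<le> b then \<gamma> t else \<delta> t)" for t
  have "continuous_on {a..c} (\<lambda>t. \<eta> t i)" if "i < k" for i
  proof -
    have sets: "{t \<in> {a..c}. t \<le> b} = {a..b}" "{t \<in> {a..c}. b \<le> t} = {b..c}"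
      using assms(3,4) by auto
    have "continuous_on {a..c} (\<lambda>t. if t \<le> b then \<gamma> t i else \<delta> t i)"
      by (intro continuous_on_cases_le) (use \<gamma> \<delta> that sets in auto)
    then show ?thesis
      by (simp add: \<eta>_def if_distribR)
  qed
  moreover have "inj_on (\<eta> t) {..<k} \<and> \<eta> t ` {..<k} = p t" if "t \<in> {a..c}" for t
    using \<gamma>(2)[of t] \<delta>(2)[of t] that by (auto simp: \<eta>_def)
  moreover have "\<eta> a i = f i \<and> \<eta> c i = f'' i" if "i < k" for i
    using \<gamma>(3)[OF that] \<delta>(3)[OF that] assms(3,4) by (auto simp: \<eta>_def)
  ultimately show ?thesis
    unfolding conf_transport_def by blast
qed

lemma Hausdorff_space_euclidean_t2: "Hausdorff_space (euclidean :: 'a::t2_space topology)"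
  unfolding Hausdorff_space_def disjnt_def by (metis hausdorff open_openin)

text \<open>Two lifts agree at time \<open>t\<close> iff \<open>\<gamma> t i \<noteq> \<delta> t j\<close> whenever \<open>i \<noteq> j\<close>, so the set of times of
  agreement is both closed and open.\<close>

lemma conf_transport_unique:
  fixes p :: "real \<Rightarrow> 'a::t2_space set"
  assumes "conf_transport k p a b f f'" "conf_transport k p a b f f''" "a \<le> b" "i < k"
  shows "f' i = f'' i"
proof -
  obtain \<gamma> where \<gamma>: "\<And>i. i<k \<Longrightarrow> continuous_on {a..b} (\<lambda>t. \<gamma> t i)"
      "\<And>t. t\<in>{a..b} \<Longrightarrow> inj_on (\<gamma> t) {..<k} \<and> \<gamma> t ` {..<k} = p t"
      "\<And>i. i<k \<Longrightarrow> \<gamma> a i = f i \<and> \<gamma> b i = f' i"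
    using assms(1) unfolding conf_transport_def by blast
  obtain \<delta> where \<delta>: "\<And>i. i<k \<Longrightarrow> continuous_on {a..b} (\<lambda>t. \<delta> t i)"
      "\<And>t. t\<in>{a..b} \<Longrightarrow> inj_on (\<delta> t) {..<k} \<and> \<delta> t ` {..<k} = p t"
      "\<And>i. i<k \<Longrightarrow> \<delta> a i = f i \<and> \<delta> b i = f'' i"
    using assms(2) unfolding conf_transport_def by blast
  define E where "E i j = {t \<in> {a..b}. \<gamma> t i = \<delta> t j}" for i j
  have clE: "closedin (top_of_set {a..b}) (E i j)" if "i < k" "j < k" for i j
    using closedin_continuous_maps_eq[of euclidean "top_of_set {a..b}" "\<lambda>t. \<gamma> t i" "\<lambda>t. \<delta> t j"]
      \<gamma>(1)[OF that(1)] \<delta>(1)[OF that(2)]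
    by (simp add: E_def Hausdorff_space_euclidean_t2)
  define T where "T = {t \<in> {a..b}. \<forall>i<k. \<gamma> t i = \<delta> t i}"
  have agree: "(\<forall>i<k. \<gamma> t i = \<delta> t i) \<longleftrightarrow> (\<forall>i<k. \<forall>j<k. i \<noteq> j \<longrightarrow> \<gamma> t i \<noteq> \<delta> t j)"
    if t: "t \<in> {a..b}" for t
  proof (intro iffI allI impI)
    fix i j assume "\<forall>i<k. \<gamma> t i = \<delta> t i" "i < k" "j < k" "i \<noteq> j"
    then show "\<gamma> t i \<noteq> \<delta> t j"
      using \<gamma>(2)[OF t] by (metis inj_onD lessThan_iff)
  next
    fix i assume *: "\<forall>i<k. \<forall>j<k. i \<noteq> j \<longrightarrow> \<gamma> t i \<noteq> \<delta> t j" "i < k"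
    have "\<gamma> t i \<in> \<delta> t ` {..<k}"
      using \<gamma>(2)[OF t] \<delta>(2)[OF t] \<open>i < k\<close> by blast
    then show "\<gamma> t i = \<delta> t i"
      using * by auto
  qed
  have "T = {t \<in> {a..b}. \<forall>i<k. \<forall>j<k. i \<noteq> j \<longrightarrow> \<gamma> t i \<noteq> \<delta> t j}"
    unfolding T_def using agree by blast
  also have "\<dots> = {a..b} - (\<Union>(i,j)\<in>{(i,j). i < k \<and> j < k \<and> i \<noteq> j}. E i j)"
    by (auto simp: E_def)
  finally have "T = {a..b} - (\<Union>(i,j)\<in>{(i,j). i < k \<and> j < k \<and> i \<noteq> j}. E i j)" .
  moreover have "finite {(i,j). i < k \<and> j < k \<and> i \<noteq> j}"
    by (rule finite_subset[of _ "{..<k} \<times> {..<k}"]) auto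
  ultimately have "openin (top_of_set {a..b}) T"
    using clE by (auto intro!: openin_diff closedin_Union)
  \<comment> \<open>The assumption \<open>i < k\<close> makes this intersection range over a
    nonempty family, which \<open>closedin_Inter\<close> asks for.\<close>
  moreover have "T = {a..b} \<inter> (\<Inter>i<k. E i i)"
    by (auto simp: T_def E_def)
  then have "closedin (top_of_set {a..b}) T"
    using clE assms(4) by (auto intro!: closedin_Int closedin_Inter)
  moreover have "a \<in> T"
    using \<gamma>(3) \<delta>(3) assms(3) by (auto simp: T_def)
  ultimately have "T = {a..b}"
    using connected_Icc[of a b] unfolding connected_clopen by blast
  then have "b \<in> T"
    using assms(3) by auto
  then show ?thesis
    using \<gamma>(3)[OF assms(4)] \<delta>(3)[OF assms(4)] assms(4) by (auto simp: T_def)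
qed

text \<open>Each \<open>y\<close> receives the finite intersection of its sides of all separating
  pairs, both those chosen for \<open>(y,z)\<close> and those chosen for \<open>(z,y)\<close>. Then
  the sets at \<open>y\<close> and \<open>z\<close> lie in \<open>U y z\<close> and
  \<open>V y z\<close>, which are disjoint.\<close>

lemma finite_separation_t2:
  fixes S :: "'a::t2_space set"
  assumes "finite S"
  obtains O' where "\<And>y. y \<in> S \<Longrightarrow> open (O' y)" "\<And>y. y \<in> S \<Longrightarrow> y \<in> O' y"
    "\<And>y z. y \<in> S \<Longrightarrow> z \<in> S \<Longrightarrow> y \<noteq> z \<Longrightarrow> O' y \<inter> O' z = {}"
proof -
  have "\<forall>y z. \<exists>U V. (y::'a) \<noteq> z \<longrightarrow> open U \<and> open V \<and> y \<in> U \<and> z \<in> V \<and> U \<inter> V = {}"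
    by (metis hausdorff)
  then obtain U V where UV: "\<And>y z. (y::'a) \<noteq> z \<Longrightarrow>
      open (U y z) \<and> open (V y z) \<and> y \<in> U y z \<and> z \<in> V y z \<and> U y z \<inter> V y z = {}"
    by metis
  show thesis
  proof
    fix y
    show "open (\<Inter>z\<in>S - {y}. U y z \<inter> V z y)"
      using UV assms by (intro open_INT ballI open_Int) auto
    show "y \<in> (\<Inter>z\<in>S - {y}. U y z \<inter> V z y)"
    proof (intro INT_I IntI)
      fix z assume "z \<in> S - {y}"
      then show "y \<in> U y z" "y \<in> V z y"
        using UV[of y z] UV[of z y] by auto
    qed
    fix z assume "y \<in> S" "z \<in> S" "y \<noteq> z"
    then have "(\<Inter>w\<in>S - {y}. U y w \<inter> V w y) \<inter> (\<Inter>w\<in>S - {z}. U z w \<inter> V w z) \<subseteq> U y z \<inter> V y z"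
      by blast
    then show "(\<Inter>w\<in>S - {y}. U y w \<inter> V w y) \<inter> (\<Inter>w\<in>S - {z}. U z w \<inter> V w z) = {}"
      using UV[OF \<open>y \<noteq> z\<close>] by blast
  qed
qed

text \<open>Choosing a point of \<open>S\<close> in each \<open>O' y\<close> is injective by
  disjointness, hence exhausts \<open>S\<close> by counting. So no \<open>O' y\<close> contains a
  second point of \<open>S\<close>, and \<open>THE\<close> is well defined.\<close>

lemma bij_betw_select:
  assumes "finite S" "finite S0" "card S = card S0"
    and disj: "\<And>y z. y \<in> S0 \<Longrightarrow> z \<in> S0 \<Longrightarrow> y \<noteq> z \<Longrightarrow> O' y \<inter> O' z = {}"
    and meet: "\<And>y. y \<in> S0 \<Longrightarrow> S \<inter> O' y \<noteq> {}"
  shows "bij_betw (\<lambda>y. THE s. s \<in> S \<inter> O' y) S0 S"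
    and "y \<in> S0 \<Longrightarrow> s \<in> S \<inter> O' y \<longleftrightarrow> s = (THE s. s \<in> S \<inter> O' y)"
proof -
  have "\<forall>y\<in>S0. \<exists>s. s \<in> S \<inter> O' y"
    using meet by blast
  then obtain m where m: "\<And>y. y \<in> S0 \<Longrightarrow> m y \<in> S \<inter> O' y"
    by metis
  have inj: "inj_on m S0"
    using m disj by (metis IntD2 IntI empty_iff inj_onI)
  have img: "m ` S0 = S"
    using m inj assms(1-3) by (intro card_subset_eq) (auto simp: card_image)
  have eq: "s \<in> S \<inter> O' y \<longleftrightarrow> s = m y" if "y \<in> S0" for y s
  proof
    assume s: "s \<in> S \<inter> O' y"
    then obtain z where "z \<in> S0" "s = m z"
      using img by auto
    then show "s = m y"
      using s m[of z] disj[of z y] that by auto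
  qed (use m that in auto)
  then have the: "(THE s. s \<in> S \<inter> O' y) = m y" if "y \<in> S0" for y
    using that by (intro the_equality) auto
  show "bij_betw (\<lambda>y. THE s. s \<in> S \<inter> O' y) S0 S"
    using inj img the by (simp add: bij_betw_def cong: inj_on_cong image_cong)
  show "y \<in> S0 \<Longrightarrow> s \<in> S \<inter> O' y \<longleftrightarrow> s = (THE s. s \<in> S \<inter> O' y)"
    using eq the by simp
qed

text \<open>Near a configuration \<open>S0\<close>, every configuration has exactly one point in each of a family of
  disjoint neighbourhoods of the points of \<open>S0\<close>, and transport keeps each label in its
  neighbourhood.\<close>

lemma conf_transport_local:
  fixes h :: "real \<times> 'x \<Rightarrow> 'a::t2_space set"
  assumes h: "continuous_map (prod_topology (top_of_set {0..1}) X) (Bconf euclidean k) h"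
    and x: "x \<in> topspace X" and t0: "t0 \<in> {0..1}"
  obtains d V where "d > 0" "openin X V" "x \<in> V"
    "\<And>a b V' g0. \<lbrakk>0 \<le> a; a \<le> t0; t0 \<le> b; b \<le> 1; b - a < d; V' \<subseteq> V;
        continuous_map (subtopology X V') (Fconf euclidean k) g0;
        \<And>v. v \<in> V' \<Longrightarrow> conf_quot k (g0 v) = h (a,v)\<rbrakk> \<Longrightarrow>
      \<exists>g1. continuous_map (subtopology X V') (Fconf euclidean k) g1 \<and>
           (\<forall>v\<in>V'. conf_quot k (g1 v) = h (b,v) \<and> conf_transport k (\<lambda>t. h (t,v)) a b (g0 v) (g1 v))"
proof -
  have htop: "h (t,v) \<in> topspace (Bconf euclidean k)" if "t \<in> {0..1}" "v \<in> topspace X" for t v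
    using continuous_map_funspace[OF h] that by (auto simp: Pi_iff)
  define S0 where "S0 = h (t0,x)"
  have S0: "finite S0" "card S0 = k"
    using htop[OF t0 x] by (auto simp: S0_def topspace_Bconf)
  obtain O' where op: "\<And>y. y \<in> S0 \<Longrightarrow> open (O' y)" and mem: "\<And>y. y \<in> S0 \<Longrightarrow> y \<in> O' y"
    and disj: "\<And>y z. y \<in> S0 \<Longrightarrow> z \<in> S0 \<Longrightarrow> y \<noteq> z \<Longrightarrow> O' y \<inter> O' z = {}"
    using finite_separation_t2[OF S0(1)] by metis
  \<comment> \<open>Membership in \<open>W\<close> only asks that every \<open>O' y\<close> be hit,
    which is an open condition; by counting, each is then hit exactly once.\<close>
  define W where "W = topspace (Bconf (euclidean::'a topology) k) \<inter>
      (\<Inter>y\<in>S0. {S \<in> topspace (Bconf euclidean k). S \<inter> O' y \<noteq> {}})"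
  have "openin (Bconf euclidean k) W"
  proof (cases "S0 = {}")
    case False
    then show ?thesis
      unfolding W_def using op S0(1)
      by (intro openin_Int openin_INT2 openin_Bconf_meet) auto
  qed (simp add: W_def)
  then have oph: "openin (prod_topology (top_of_set {0..1}) X)
      {z \<in> topspace (prod_topology (top_of_set {0..1}) X). h z \<in> W}"
    using h by (intro openin_continuous_map_preimage)
  have t0x: "(t0,x) \<in> {z \<in> topspace (prod_topology (top_of_set {0..1}) X). h z \<in> W}"
    using t0 x htop[OF t0 x] mem by (auto simp: W_def S0_def)
  obtain J V where J: "openin (top_of_set {0..1}) J" and V: "openin X V"
    and "t0 \<in> J" "x \<in> V"
    and JV: "J \<times> V \<subseteq> {z \<in> topspace (prod_topology (top_of_set {0..1}) X). h z \<in> W}"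
    using oph[unfolded openin_prod_topology_alt, rule_format, OF t0x]
    by (elim exE conjE) (rule that)
  obtain d where d: "d > 0" "ball t0 d \<inter> {0..1} \<subseteq> J"
    using J \<open>t0 \<in> J\<close> unfolding openin_contains_ball by blast
  define e where "e S y = (THE s. s \<in> S \<inter> O' y)" for S y
  have bij: "bij_betw (e S) S0 S" if "S \<in> W" for S
    unfolding e_def using that S0 disj
    by (intro bij_betw_select(1)) (auto simp: W_def topspace_Bconf)
  have eiff: "s \<in> S \<inter> O' y \<longleftrightarrow> s = e S y" if "S \<in> W" "y \<in> S0" for S y s
    unfolding e_def using that S0 disj
    by (intro bij_betw_select(2)) (auto simp: W_def topspace_Bconf)
  \<comment> \<open>This rewrites a condition on the selected point as a hit condition on
    \<open>S\<close>, and so is the continuity of \<open>S \<mapsto> e S y\<close> on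
    \<open>W\<close>.\<close>
  have esel: "e S y \<in> Q \<longleftrightarrow> S \<inter> (O' y \<inter> Q) \<noteq> {}" if "S \<in> W" "y \<in> S0" for S y Q
    using eiff[OF that] by (metis Int_assoc Int_iff ex_in_conv)
  show thesis
  proof
    fix a b V' g0
    assume a: "0 \<le> a" "a \<le> t0" and b: "t0 \<le> b" "b \<le> 1" and bd: "b - a < d" and V': "V' \<subseteq> V"
      and g0: "continuous_map (subtopology X V') (Fconf euclidean k) g0"
      and g0q: "\<And>v. v \<in> V' \<Longrightarrow> conf_quot k (g0 v) = h (a,v)"
    have V'X: "V' \<subseteq> topspace X"
      using V V' openin_subset by blast
    have hW: "h (t,v) \<in> W" if "t \<in> {a..b}" "v \<in> V'" for t v
    proof -
      have "t \<in> ball t0 d \<inter> {0..1}"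
        using that(1) a b bd by (auto simp: dist_real_def)
      then show ?thesis
        using d(2) JV that(2) V' by blast
    qed
    have g0inj: "inj_on (g0 v) {..<k}" if "v \<in> V'" for v
      using g0 that V'X by (auto simp: continuous_map_into_Fconf topspace_Fconf Pi_iff)
    \<comment> \<open>The point of \<open>S0\<close> whose neighbourhood contains
      \<open>g0 v i\<close>. The label \<open>i\<close> is kept in this neighbourhood while
      \<open>t\<close> runs from \<open>a\<close> to \<open>b\<close>.\<close>
    define l where "l v i = (SOME y. y \<in> S0 \<and> g0 v i \<in> O' y)" for v i
    have l: "l v i \<in> S0" "e (h (a,v)) (l v i) = g0 v i" "g0 v i \<in> O' (l v i)"
      if "v \<in> V'" "i < k" for v i
    proof -
      have aW: "h (a,v) \<in> W"
        using hW that(1) a b by auto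
      have gh: "g0 v i \<in> h (a,v)"
        using g0q[OF that(1)] that(2) by (auto simp: conf_quot_def)
      then obtain y where "y \<in> S0" "e (h (a,v)) y = g0 v i"
        using bij[OF aW] by (metis bij_betw_imp_surj_on imageE)
      then have "y \<in> S0 \<and> g0 v i \<in> O' y"
        using eiff[OF aW, of y] by auto
      then have *: "l v i \<in> S0 \<and> g0 v i \<in> O' (l v i)"
        unfolding l_def by (rule someI)
      then show "l v i \<in> S0" "g0 v i \<in> O' (l v i)" by auto
      show "e (h (a,v)) (l v i) = g0 v i"
        using eiff[OF aW, of "l v i" "g0 v i"] * gh by auto
    qed
    have lbij: "bij_betw (l v) {..<k} S0" if v: "v \<in> V'" for v
    proof -
      have "inj_on (l v) {..<k}"
        using l(2)[OF v] g0inj[OF v] by (metis inj_on_def lessThan_iff)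
      moreover have "l v ` {..<k} = S0"
        using l(1)[OF v] S0 calculation by (intro card_subset_eq) (auto simp: card_image)
      ultimately show ?thesis by (simp add: bij_betw_def)
    qed
    define \<gamma> where "\<gamma> v t i = e (h (t,v)) (l v i)" for v t i
    have \<gamma>bij: "bij_betw (\<gamma> v t) {..<k} (h (t,v))" if "t \<in> {a..b}" "v \<in> V'" for t v
      using bij_betw_trans[OF lbij[OF that(2)] bij[OF hW[OF that]]]
      by (simp add: \<gamma>_def[abs_def] o_def)
    have slice: "continuous_map (top_of_set {a..b}) (Bconf euclidean k) (\<lambda>t. h (t,v))"
      if "v \<in> V'" for v
    proof -
      have "continuous_map (top_of_set {a..b}) (prod_topology (top_of_set {0..1}) X) (\<lambda>t. (t,v))"
        using a b that V'X by (auto simp: continuous_map_pairwise o_def)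
      from continuous_map_compose[OF this h] show ?thesis
        by (simp add: o_def)
    qed
    have slice': "continuous_map (subtopology X V') (Bconf euclidean k) (\<lambda>v. h (b,v))"
    proof -
      have "continuous_map (subtopology X V') (prod_topology (top_of_set {0..1}) X) (\<lambda>v. (b,v))"
        using a b by (auto simp: continuous_map_pairwise o_def)
      from continuous_map_compose[OF this h] show ?thesis
        by (simp add: o_def)
    qed
    have meet_op: "openin (Bconf euclidean k) {S \<in> topspace (Bconf euclidean k). S \<inter> (O' y \<inter> Q) \<noteq> {}}"
      if "y \<in> S0" "open Q" for y Q
      using op that by (intro openin_Bconf_meet) auto
    have \<gamma>cont: "continuous_on {a..b} (\<lambda>t. \<gamma> v t i)" if v: "v \<in> V'" and i: "i < k" for v i
    proof -
      have "openin (top_of_set {a..b}) {t \<in> {a..b}. \<gamma> v t i \<in> Q}" if "open Q" for Q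
      proof -
        have "{t \<in> {a..b}. \<gamma> v t i \<in> Q} = {t \<in> topspace (top_of_set {a..b}).
            h (t,v) \<in> {S \<in> topspace (Bconf euclidean k). S \<inter> (O' (l v i) \<inter> Q) \<noteq> {}}}"
          using esel[OF hW[OF _ v] l(1)[OF v i]] hW[OF _ v] by (auto simp: \<gamma>_def W_def)
        then show ?thesis
          using openin_continuous_map_preimage[OF slice[OF v] meet_op[OF l(1)[OF v i] that]] by simp
      qed
      then have "continuous_map (top_of_set {a..b}) euclidean (\<lambda>t. \<gamma> v t i)"
        by (auto simp: continuous_map)
      then show ?thesis by simp
    qed
    define g1 where "g1 v = restrict (\<gamma> v b) {..<k}" for v
    have bab: "b \<in> {a..b}" "a \<in> {a..b}"
      using a b by auto
    have "continuous_map (subtopology X V') euclidean (\<lambda>v. g1 v i)" if i: "i < k" for i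
    proof -
      have "openin (subtopology X V') {v \<in> V'. g1 v i \<in> Q}" if "open Q" for Q
      proof -
        \<comment> \<open>The neighbourhood \<open>l v i\<close> of label \<open>i\<close> varies
          with \<open>v\<close>, so the preimage is split according to the \<open>y\<close> with
          \<open>g0 v i \<in> O' y\<close>. Each piece is open by continuity of \<open>g0\<close>
          and of \<open>h\<close>.\<close>
        have "{v \<in> V'. g1 v i \<in> Q} = (\<Union>y\<in>S0. {v \<in> topspace (subtopology X V'). g0 v i \<in> O' y} \<inter>
           {v \<in> topspace (subtopology X V').
              h (b,v) \<in> {S \<in> topspace (Bconf euclidean k). S \<inter> (O' y \<inter> Q) \<noteq> {}}})"
          (is "?L = ?R")
        proof -
          have "v \<in> ?L \<longleftrightarrow> v \<in> ?R" if v: "v \<in> V'" for v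
          proof -
            have hb: "h (b,v) \<in> topspace (Bconf euclidean k)"
              using hW[OF bab(1) v] by (simp add: W_def)
            have ly: "y = l v i" if "y \<in> S0" "g0 v i \<in> O' y" for y
              using disj[OF that(1) l(1)[OF v i]] that(2) l(3)[OF v i] by blast
            have "v \<in> ?L \<longleftrightarrow> h (b,v) \<inter> (O' (l v i) \<inter> Q) \<noteq> {}"
              using esel[OF hW[OF bab(1) v] l(1)[OF v i], of Q] v i by (simp add: g1_def \<gamma>_def)
            also have "\<dots> \<longleftrightarrow> (\<exists>y\<in>S0. g0 v i \<in> O' y \<and> h (b,v) \<inter> (O' y \<inter> Q) \<noteq> {})"
              using ly l(1,3)[OF v i] by blast
            also have "\<dots> \<longleftrightarrow> v \<in> ?R"
              using v V'X hb by (simp add: subset_iff)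
            finally show ?thesis .
          qed
          then show ?thesis using V'X by auto
        qed
        moreover have "openin (subtopology X V') {v \<in> topspace (subtopology X V'). g0 v i \<in> O' y}"
          if "y \<in> S0" for y
          using g0 i op[OF that] by (intro openin_continuous_map_preimage) (auto simp: continuous_map_into_Fconf)
        moreover have "openin (subtopology X V') {v \<in> topspace (subtopology X V').
              h (b,v) \<in> {S \<in> topspace (Bconf euclidean k). S \<inter> (O' y \<inter> Q) \<noteq> {}}}" if "y \<in> S0" for y
          by (rule openin_continuous_map_preimage[OF slice' meet_op[OF that \<open>open Q\<close>]])
        ultimately show ?thesis
          by (auto intro!: openin_Union openin_Int)
      qed
      then show ?thesis
        using V'X by (auto simp: continuous_map Int_absorb1)
    qed
    moreover have "g1 v \<in> topspace (Fconf euclidean k)" if "v \<in> V'" for v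
      using \<gamma>bij[OF bab(1) that] by (auto simp: g1_def topspace_Fconf bij_betw_def)
    ultimately have "continuous_map (subtopology X V') (Fconf euclidean k) g1"
      by (auto simp: continuous_map_into_Fconf)
    moreover have "conf_quot k (g1 v) = h (b,v)" if "v \<in> V'" for v
      using \<gamma>bij[OF bab(1) that] by (simp add: g1_def bij_betw_def)
    moreover have "conf_transport k (\<lambda>t. h (t,v)) a b (g0 v) (g1 v)" if v: "v \<in> V'" for v
      unfolding conf_transport_def
    proof (intro exI[of _ "\<gamma> v"] conjI allI impI ballI)
      show "\<gamma> v a i = g0 v i" if "i < k" for i
        using l(2)[OF v that] by (simp add: \<gamma>_def)
    qed (use \<gamma>cont[OF v] \<gamma>bij[OF _ v] in \<open>auto simp: bij_betw_def g1_def\<close>)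
    ultimately show "\<exists>g1. continuous_map (subtopology X V') (Fconf euclidean k) g1 \<and>
           (\<forall>v\<in>V'. conf_quot k (g1 v) = h (b,v) \<and> conf_transport k (\<lambda>t. h (t,v)) a b (g0 v) (g1 v))"
      by blast
  qed (use d V \<open>x \<in> V\<close> in auto)
qed

text \<open>The end of the lifted homotopy, as in homotopy lifting for coverings. Subdividing
  \<open>{0..1}\<close> gives a transport over a neighbourhood of each point; uniqueness of
  transport lets these local results be pasted.\<close>

lemma conf_homotopy_lifting:
  fixes h :: "real \<times> 'x \<Rightarrow> 'a::t2_space set"
  assumes h: "continuous_map (prod_topology (top_of_set {0..1}) X) (Bconf euclidean k) h"
    and g0: "continuous_map X (Fconf euclidean k) g0"
    and g0q: "\<And>x. x \<in> topspace X \<Longrightarrow> conf_quot k (g0 x) = h (0,x)"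
  obtains g where "continuous_map X (Fconf euclidean k) g"
    "\<And>x. x \<in> topspace X \<Longrightarrow> conf_quot k (g x) = h (1,x)"
proof -
  \<comment> \<open>Quantifying over all \<open>V' \<subseteq> V\<close> and all starting lifts
    makes \<open>P\<close> additive in the interval: neighbourhoods are intersected, and the end of
    one transport starts the next. The guards \<open>0 \<le> a\<close> and \<open>b \<le> 1\<close>
    are there because \<open>Bolzano\<close> also tests intervals protruding from
    \<open>{0..1}\<close>.\<close>
  define P where "P x a b \<longleftrightarrow> 0 \<le> a \<longrightarrow> b \<le> 1 \<longrightarrow>
     (\<exists>V. openin X V \<and> x \<in> V \<and> (\<forall>V' g0. V' \<subseteq> V \<longrightarrow>
        continuous_map (subtopology X V') (Fconf euclidean k) g0 \<longrightarrow>
        (\<forall>v\<in>V'. conf_quot k (g0 v) = h (a,v)) \<longrightarrow>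
      (\<exists>g1. continuous_map (subtopology X V') (Fconf euclidean k) g1 \<and>
           (\<forall>v\<in>V'. conf_quot k (g1 v) = h (b,v) \<and>
              conf_transport k (\<lambda>t. h (t,v)) a b (g0 v) (g1 v)))))" for x and a b :: real
  have P01: "P x 0 1" if x: "x \<in> topspace X" for x
  proof (rule Bolzano)
    fix a b c assume ab: "P x a b" and bc: "P x b c" and le: "a \<le> b" "b \<le> c"
    show "P x a c"
      unfolding P_def
    proof (intro impI)
      assume "0 \<le> a" "c \<le> 1"
      obtain V1 where V1: "openin X V1" "x \<in> V1"
        and 1: "\<And>V' g0. V' \<subseteq> V1 \<Longrightarrow> continuous_map (subtopology X V') (Fconf euclidean k) g0 \<Longrightarrow>
        (\<forall>v\<in>V'. conf_quot k (g0 v) = h (a,v)) \<Longrightarrow>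
      (\<exists>g1. continuous_map (subtopology X V') (Fconf euclidean k) g1 \<and>
           (\<forall>v\<in>V'. conf_quot k (g1 v) = h (b,v) \<and> conf_transport k (\<lambda>t. h (t,v)) a b (g0 v) (g1 v)))"
        using ab \<open>0 \<le> a\<close> \<open>c \<le> 1\<close> le unfolding P_def by auto
      obtain V2 where V2: "openin X V2" "x \<in> V2"
        and 2: "\<And>V' g0. V' \<subseteq> V2 \<Longrightarrow> continuous_map (subtopology X V') (Fconf euclidean k) g0 \<Longrightarrow>
        (\<forall>v\<in>V'. conf_quot k (g0 v) = h (b,v)) \<Longrightarrow>
      (\<exists>g1. continuous_map (subtopology X V') (Fconf euclidean k) g1 \<and>
           (\<forall>v\<in>V'. conf_quot k (g1 v) = h (c,v) \<and> conf_transport k (\<lambda>t. h (t,v)) b c (g0 v) (g1 v)))"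
        using bc \<open>0 \<le> a\<close> \<open>c \<le> 1\<close> le unfolding P_def by auto
      show "\<exists>V. openin X V \<and> x \<in> V \<and> (\<forall>V' g0. V' \<subseteq> V \<longrightarrow>
        continuous_map (subtopology X V') (Fconf euclidean k) g0 \<longrightarrow>
        (\<forall>v\<in>V'. conf_quot k (g0 v) = h (a,v)) \<longrightarrow>
      (\<exists>g1. continuous_map (subtopology X V') (Fconf euclidean k) g1 \<and>
           (\<forall>v\<in>V'. conf_quot k (g1 v) = h (c,v) \<and>
              conf_transport k (\<lambda>t. h (t,v)) a c (g0 v) (g1 v))))"
      proof (intro exI[of _ "V1 \<inter> V2"] conjI allI impI)
        fix V' g0 assume *: "V' \<subseteq> V1 \<inter> V2" "continuous_map (subtopology X V') (Fconf euclidean k) g0"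
          "\<forall>v\<in>V'. conf_quot k (g0 v) = h (a,v)"
        obtain g1 where g1: "continuous_map (subtopology X V') (Fconf euclidean k) g1"
           "\<forall>v\<in>V'. conf_quot k (g1 v) = h (b,v) \<and> conf_transport k (\<lambda>t. h (t,v)) a b (g0 v) (g1 v)"
          using 1[OF _ *(2,3)] *(1) by auto
        then have "\<forall>v\<in>V'. conf_quot k (g1 v) = h (b,v)" by blast
        then obtain g2 where g2: "continuous_map (subtopology X V') (Fconf euclidean k) g2"
           "\<forall>v\<in>V'. conf_quot k (g2 v) = h (c,v) \<and> conf_transport k (\<lambda>t. h (t,v)) b c (g1 v) (g2 v)"
          using 2[OF _ g1(1)] *(1) by auto
        have "conf_transport k (\<lambda>t. h (t,v)) a c (g0 v) (g2 v)" if "v \<in> V'" for v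
          using g1(2) g2(2) that conf_transport_trans[OF _ _ le] by blast
        then show "\<exists>g1. continuous_map (subtopology X V') (Fconf euclidean k) g1 \<and>
           (\<forall>v\<in>V'. conf_quot k (g1 v) = h (c,v) \<and> conf_transport k (\<lambda>t. h (t,v)) a c (g0 v) (g1 v))"
          using g2 by blast
      qed (use V1 V2 in auto)
    qed
  next
    fix t0 :: real assume "0 \<le> t0" "t0 \<le> 1"
    then have "t0 \<in> {0..1}" by auto
    from conf_transport_local[OF h x this] obtain d V where d: "d > 0" and V: "openin X V" "x \<in> V"
      and *: "\<And>a b V' g0. \<lbrakk>0 \<le> a; a \<le> t0; t0 \<le> b; b \<le> 1; b - a < d; V' \<subseteq> V;
        continuous_map (subtopology X V') (Fconf euclidean k) g0;
        \<And>v. v \<in> V' \<Longrightarrow> conf_quot k (g0 v) = h (a,v)\<rbrakk> \<Longrightarrow>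
      \<exists>g1. continuous_map (subtopology X V') (Fconf euclidean k) g1 \<and>
           (\<forall>v\<in>V'. conf_quot k (g1 v) = h (b,v) \<and> conf_transport k (\<lambda>t. h (t,v)) a b (g0 v) (g1 v))"
      by metis
    have "P x a b" if "a \<le> t0" "t0 \<le> b" "b - a < d" for a b
      unfolding P_def by (intro impI exI[of _ V] conjI V allI *) (use that in auto)
    then show "\<exists>d>0. \<forall>a b. a \<le> t0 \<and> t0 \<le> b \<and> b - a < d \<longrightarrow> P x a b"
      using d by blast
  qed simp
  have "\<exists>V g1. openin X V \<and> x \<in> V \<and> continuous_map (subtopology X V) (Fconf euclidean k) g1 \<and>
           (\<forall>v\<in>V. conf_quot k (g1 v) = h (1,v) \<and> conf_transport k (\<lambda>t. h (t,v)) 0 1 (g0 v) (g1 v))"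
    if x: "x \<in> topspace X" for x
  proof -
    obtain V where V: "openin X V" "x \<in> V"
      and *: "\<forall>V' g0. V' \<subseteq> V \<longrightarrow> continuous_map (subtopology X V') (Fconf euclidean k) g0 \<longrightarrow>
        (\<forall>v\<in>V'. conf_quot k (g0 v) = h (0,v)) \<longrightarrow>
      (\<exists>g1. continuous_map (subtopology X V') (Fconf euclidean k) g1 \<and>
           (\<forall>v\<in>V'. conf_quot k (g1 v) = h (1,v) \<and>
              conf_transport k (\<lambda>t. h (t,v)) 0 1 (g0 v) (g1 v)))"
      using P01[OF x] unfolding P_def by auto
    have "\<forall>v\<in>V. conf_quot k (g0 v) = h (0,v)"
      using g0q openin_subset[OF V(1)] by blast
    then obtain g1 where "continuous_map (subtopology X V) (Fconf euclidean k) g1"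
        "\<forall>v\<in>V. conf_quot k (g1 v) = h (1,v) \<and> conf_transport k (\<lambda>t. h (t,v)) 0 1 (g0 v) (g1 v)"
      using *[rule_format, OF order_refl continuous_map_from_subtopology[OF g0]] by blast
    with V show ?thesis
      by blast
  qed
  then obtain V G where V: "\<And>x. x \<in> topspace X \<Longrightarrow> openin X (V x) \<and> x \<in> V x"
    and G: "\<And>x. x \<in> topspace X \<Longrightarrow> continuous_map (subtopology X (V x)) (Fconf euclidean k) (G x)"
    and Gq: "\<And>x v. x \<in> topspace X \<Longrightarrow> v \<in> V x \<Longrightarrow> conf_quot k (G x v) = h (1,v)"
    and Gt: "\<And>x v. x \<in> topspace X \<Longrightarrow> v \<in> V x \<Longrightarrow> conf_transport k (\<lambda>t. h (t,v)) 0 1 (g0 v) (G x v)"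
    by metis
  \<comment> \<open>Transport determines a tuple on \<open>{..<k}\<close>; extensionality turns this
    into equality of functions.\<close>
  have Gext: "G x v \<in> extensional {..<k}" if "x \<in> topspace X" "v \<in> V x" "v \<in> topspace X" for x v
    using G[OF that(1)] that(2,3) by (auto simp: continuous_map_into_Fconf topspace_Fconf PiE_def Pi_iff)
  have agree: "G x v = G y v" if "x \<in> topspace X" "y \<in> topspace X" "v \<in> topspace X \<inter> V x \<inter> V y" for x y v
  proof (rule extensionalityI[OF Gext Gext])
    show "G x v i = G y v i" if "i \<in> {..<k}" for i
      using conf_transport_unique[OF Gt Gt, of x v y i] that
        \<open>x \<in> topspace X\<close> \<open>y \<in> topspace X\<close> \<open>v \<in> topspace X \<inter> V x \<inter> V y\<close> by auto
  qed (use that in auto)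
  show thesis
  proof
    \<comment> \<open>By \<open>agree\<close>, the diagonal choice \<open>G x x\<close> equals
      \<open>G y x\<close> for all \<open>x\<close> in \<open>V y\<close>, so it is continuous
      there.\<close>
    show "continuous_map X (Fconf euclidean k) (\<lambda>x. G x x)"
      by (rule pasting_lemma[of "topspace X" X V _ G]) (use V G agree in blast)+
    show "conf_quot k (G x x) = h (1,x)" if "x \<in> topspace X" for x
      using Gq that V by blast
  qed
qed

section \<open>Extending local sections to neighbourhoods\<close>

text \<open>The preimage of \<open>U\<close> under the map induced by \<open>\<phi>\<close>, which
  exists only where \<open>\<phi>\<close> is injective. No space \<open>M\<close> enters, so one set
  serves every finite stage and the colimit.\<close>

definition conf_over :: "('a \<Rightarrow> 'b) \<Rightarrow> 'b set set \<Rightarrow> 'a set set" where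
  "conf_over \<phi> U = {S. inj_on \<phi> S \<and> \<phi> ` S \<in> U}"

text \<open>A section over \<open>U\<close> orders the points of \<open>S \<in> conf_over \<phi> U\<close> by ordering their images.\<close>

definition conf_pull_section :: "nat \<Rightarrow> ('a \<Rightarrow> 'b) \<Rightarrow> ('b set \<Rightarrow> nat \<Rightarrow> 'b) \<Rightarrow> 'a set \<Rightarrow> nat \<Rightarrow> 'a" where
  "conf_pull_section k \<phi> s S = restrict (\<lambda>i. the_inv_into S \<phi> (s (\<phi> ` S) i)) {..<k}"

text \<open>The locus where \<open>\<phi>\<close> is injective is open, and on it the induced map to
  \<open>Bconf N k\<close> is continuous.\<close>

lemma openin_conf_over:
  assumes N: "Hausdorff_space N" and \<phi>: "continuous_map M N \<phi>" and U: "openin (Bconf N k) U"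
  shows "openin (Bconf M k) (topspace (Bconf M k) \<inter> conf_over \<phi> U)"
proof -
  define W where "W = {S \<in> topspace (Bconf M k). inj_on \<phi> S}"
  have W: "openin (Bconf M k) W"
    unfolding W_def by (rule openin_Bconf_inj_on[OF N \<phi>])
  have "continuous_map (subtopology (Bconf M k) W) (Bconf N k) ((`) \<phi>)"
    by (rule continuous_map_Bconf_image[OF \<phi> W]) (simp add: W_def)
  from openin_continuous_map_preimage[OF this U]
  have "openin (Bconf M k) {S \<in> topspace (subtopology (Bconf M k) W). \<phi> ` S \<in> U}"
    using W by (simp add: openin_open_subtopology)
  moreover have "{S \<in> topspace (subtopology (Bconf M k) W). \<phi> ` S \<in> U}
      = topspace (Bconf M k) \<inter> conf_over \<phi> U"
    by (auto simp: W_def conf_over_def)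
  ultimately show ?thesis by simp
qed

context
  fixes M :: "'a topology" and N :: "'b topology" and \<phi> k U s
  assumes \<phi>: "continuous_map M N \<phi>" and U: "openin (Bconf N k) U"
    and s: "continuous_map (subtopology (Bconf N k) U) (Fconf N k) s"
    and sq: "\<And>x. x \<in> U \<Longrightarrow> conf_quot k (s x) = x"
begin

text \<open>All claims come from the third: the images under \<open>\<phi>\<close> are the entries
  of \<open>s (\<phi>\<close> S)\<open>, which are distinct and fill\<close>\<phi> \<open>S\<close>.
  The fourth later prevents collisions in the first homotopy.\<close>

lemma conf_pull_section_props:
  assumes S: "S \<in> conf_over \<phi> U" "S \<in> topspace (Bconf M k)"
  shows "conf_quot k (conf_pull_section k \<phi> s S) = S"
    and "conf_pull_section k \<phi> s S \<in> topspace (Fconf M k)"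
    and "i < k \<Longrightarrow> \<phi> (conf_pull_section k \<phi> s S i) = s (\<phi> ` S) i"
    and "inj_on (\<lambda>i. \<phi> (conf_pull_section k \<phi> s S i)) {..<k}"
proof -
  have inj: "inj_on \<phi> S" and SU: "\<phi> ` S \<in> U"
    using S(1) by (auto simp: conf_over_def)
  have img: "s (\<phi> ` S) ` {..<k} = \<phi> ` S"
    using sq[OF SU] by (simp add: conf_quot_def)
  have "\<phi> ` S \<in> topspace (subtopology (Bconf N k) U)"
    using SU openin_subset[OF U] by auto
  then have "s (\<phi> ` S) \<in> topspace (Fconf N k)"
    using s by (auto simp: continuous_map_into_Fconf Pi_iff)
  then have sinj: "inj_on (s (\<phi> ` S)) {..<k}"
    by (simp add: topspace_Fconf)
  have mem: "s (\<phi> ` S) i \<in> \<phi> ` S" if "i < k" for i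
    using img that by blast
  show \<phi>s: "\<phi> (conf_pull_section k \<phi> s S i) = s (\<phi> ` S) i" if "i < k" for i
    using f_the_inv_into_f[OF inj mem[OF that]] that by (simp add: conf_pull_section_def)
  then show \<phi>inj: "inj_on (\<lambda>i. \<phi> (conf_pull_section k \<phi> s S i)) {..<k}"
    using sinj by (simp add: inj_on_def)
  have inS: "conf_pull_section k \<phi> s S i \<in> S" if "i < k" for i
    using the_inv_into_into[OF inj mem[OF that] order_refl] that by (simp add: conf_pull_section_def)
  have inj': "inj_on (conf_pull_section k \<phi> s S) {..<k}"
    using \<phi>inj by (auto simp: inj_on_def)
  show "conf_quot k (conf_pull_section k \<phi> s S) = S"
    unfolding conf_quot_def
    using S(2) inS inj' by (intro card_subset_eq) (auto simp: topspace_Bconf card_image)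
  show "conf_pull_section k \<phi> s S \<in> topspace (Fconf M k)"
    using S(2) inS inj'
    by (auto simp: topspace_Fconf topspace_Bconf PiE_iff conf_pull_section_def)
qed

text \<open>Continuity is checked on ordered tuples \<open>f\<close>. There the \<open>i\<close>-th
  point of the pulled back ordering is some \<open>f j\<close>, and the index \<open>j\<close> is
  locally constant.\<close>

lemma continuous_map_conf_pull_section:
  assumes N: "Hausdorff_space N"
  shows "continuous_map (subtopology (Bconf M k) (conf_over \<phi> U)) (Fconf M k) (conf_pull_section k \<phi> s)"
proof -
  define W where "W = topspace (Bconf M k) \<inter> conf_over \<phi> U"
  have W: "openin (Bconf M k) W"
    unfolding W_def by (rule openin_conf_over[OF N \<phi> U])
  define V where "V = {f \<in> topspace (Fconf M k). conf_quot k f \<in> W}"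
  have q: "quotient_map (subtopology (Fconf M k) V) (subtopology (Bconf M k) W) (conf_quot k)"
    using quotient_map_restriction[OF quotient_map_conf_quot V_def[symmetric]] W by blast
  have topV: "topspace (subtopology (Fconf M k) V) = V"
    by (auto simp: V_def)
  have opV: "openin (subtopology (Fconf M k) V) V"
    using openin_topspace[of "subtopology (Fconf M k) V"] unfolding topV .
  have im: "continuous_map (subtopology (Bconf M k) W) (subtopology (Bconf N k) U) ((`) \<phi>)"
    using continuous_map_Bconf_image[OF \<phi> W]
    by (auto simp: continuous_map_in_subtopology W_def conf_over_def)
  have sc: "continuous_map (subtopology (Fconf M k) V) N (\<lambda>f. s (\<phi> ` conf_quot k f) i)" if "i < k" for i
    using continuous_map_compose[OF continuous_map_compose[OF continuous_map_compose[OF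
        quotient_imp_continuous_map[OF q] im] s] continuous_map_Fconf_component[OF that]]
    by (simp add: o_def)
  have fc: "continuous_map (subtopology (Fconf M k) V) M (\<lambda>f. f j)" if "j < k" for j
    by (rule continuous_map_from_subtopology[OF continuous_map_Fconf_component[OF that]])
  have props: "conf_quot k (conf_pull_section k \<phi> s (conf_quot k f)) = conf_quot k f"
    "conf_pull_section k \<phi> s (conf_quot k f) \<in> topspace (Fconf M k)"
    "i < k \<Longrightarrow> \<phi> (conf_pull_section k \<phi> s (conf_quot k f) i) = s (\<phi> ` conf_quot k f) i"
    if "f \<in> V" for f i
    using that by (auto intro!: conf_pull_section_props simp: V_def W_def)
  have "continuous_map (subtopology (Fconf M k) V) M (\<lambda>f. conf_pull_section k \<phi> s (conf_quot k f) i)"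
    if i: "i < k" for i
    unfolding continuous_map
  proof (intro conjI allI impI)
    show "(\<lambda>f. conf_pull_section k \<phi> s (conf_quot k f) i) ` topspace (subtopology (Fconf M k) V) \<subseteq> topspace M"
      using props(2) i unfolding topV by (auto simp: topspace_Fconf)
    fix Q assume Q: "openin M Q"
    \<comment> \<open>The tuples whose \<open>j\<close>-th entry is the selected point. Saying
      instead that every other entry has the wrong image under \<open>\<phi>\<close> makes the
      condition open, as \<open>N\<close> is Hausdorff.\<close>
    define A where "A j = V \<inter> (\<Inter>j'\<in>{..<k} - {j}. V - {f \<in> V. \<phi> (f j') = s (\<phi> ` conf_quot k f) i})" for j
    have opA: "openin (subtopology (Fconf M k) V) (A j)" for j
    proof (cases "{..<k} - {j} = {}")
      case True
      then show ?thesis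
        unfolding A_def using opV by (simp only: True image_empty Inter_empty Int_UNIV_right)
    next
      case False
      have "openin (subtopology (Fconf M k) V) (V - {f \<in> V. \<phi> (f j') = s (\<phi> ` conf_quot k f) i})"
        if "j' < k" for j'
        using closedin_continuous_maps_eq[OF N _ sc[OF i], of "\<lambda>f. \<phi> (f j')"]
          continuous_map_compose[OF fc[OF that] \<phi>] opV
        unfolding topV o_def by (intro openin_diff) auto
      then show ?thesis
        unfolding A_def using False opV
        by (intro openin_Int openin_INT2) auto
    qed
    have Aiff: "f \<in> A j \<longleftrightarrow> f j = conf_pull_section k \<phi> s (conf_quot k f) i" if f: "f \<in> V" and j: "j < k" for f j
    proof -
      have S: "conf_quot k f \<in> conf_over \<phi> U" and finj: "inj_on f {..<k}"
        using f by (auto simp: V_def W_def topspace_Fconf)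
      then have "inj_on \<phi> (f ` {..<k})"
        by (simp add: conf_over_def conf_quot_def)
      then have \<phi>f: "inj_on (\<lambda>j. \<phi> (f j)) {..<k}"
        using comp_inj_on[OF finj] by (simp add: o_def)
      have "conf_pull_section k \<phi> s (conf_quot k f) i \<in> conf_quot k f"
        using props(1)[OF f] i by (auto simp: conf_quot_def)
      then obtain l where l: "l < k" "conf_pull_section k \<phi> s (conf_quot k f) i = f l"
        by (auto simp: conf_quot_def)
      have "\<phi> (f l) = s (\<phi> ` conf_quot k f) i"
        using props(3)[OF f i] l(2) by simp
      then have "f \<in> A j \<longleftrightarrow> (\<forall>j'<k. j' \<noteq> j \<longrightarrow> \<phi> (f j') \<noteq> \<phi> (f l))"
        using f by (auto simp: A_def)
      also have "\<dots> \<longleftrightarrow> j = l"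
        using \<phi>f j l(1) by (metis inj_onD lessThan_iff)
      also have "\<dots> \<longleftrightarrow> f j = f l"
        using finj j l(1) by (metis inj_onD lessThan_iff)
      finally show ?thesis
        by (simp add: l(2))
    qed
    have "{f \<in> topspace (subtopology (Fconf M k) V). conf_pull_section k \<phi> s (conf_quot k f) i \<in> Q}
        = (\<Union>j<k. A j \<inter> {f \<in> topspace (subtopology (Fconf M k) V). f j \<in> Q})" (is "?L = ?R")
    proof (intro set_eqI iffI)
      fix f assume f: "f \<in> ?L"
      then have fV: "f \<in> V" by (simp add: topV)
      have "conf_pull_section k \<phi> s (conf_quot k f) i \<in> conf_quot k f"
        using props(1)[OF fV] i by (auto simp: conf_quot_def)
      then obtain l where "l < k" "f l = conf_pull_section k \<phi> s (conf_quot k f) i"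
        by (auto simp: conf_quot_def)
      then show "f \<in> ?R"
        using f Aiff[OF fV] by auto
    next
      fix f assume "f \<in> ?R"
      then obtain j where "j < k" "f \<in> A j" "f \<in> V" "f j \<in> Q"
        by (auto simp: topV)
      then show "f \<in> ?L"
        using Aiff unfolding topV by auto
    qed
    moreover have "openin (subtopology (Fconf M k) V) {f \<in> topspace (subtopology (Fconf M k) V). f j \<in> Q}"
      if "j < k" for j
      by (rule openin_continuous_map_preimage[OF fc[OF that] Q])
    ultimately show "openin (subtopology (Fconf M k) V)
        {f \<in> topspace (subtopology (Fconf M k) V). conf_pull_section k \<phi> s (conf_quot k f) i \<in> Q}"
      using opA by (auto intro!: openin_Union openin_Int)
  qed
  then have "continuous_map (subtopology (Fconf M k) V) (Fconf M k) (conf_pull_section k \<phi> s \<circ> conf_quot k)"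
    unfolding continuous_map_into_Fconf topV using props(2) by simp
  then have "continuous_map (subtopology (Bconf M k) W) (Fconf M k) (conf_pull_section k \<phi> s)"
    by (rule continuous_compose_quotient_map[OF q])
  then show ?thesis
    unfolding W_def by (simp add: subtopology_restrict)
qed

end

section \<open>Contracting configurations in one extra dimension\<close>

text \<open>The type class topology on \<open>nat \<Rightarrow> real\<close> is the product
  topology. So every \<open>Rn n\<close> is a subspace of one \<open>t2_space\<close> type, to which
  the lifting lemma applies.\<close>

lemma Rn_eq: "Rn n = top_of_set (Rn_set n)"
  by (simp add: Rn_def euclidean_product_topology)

lemma topspace_Rn [simp]: "topspace (Rn n) = Rn_set n"
  by (simp add: Rn_eq)

lemma Rn_set_mono: "m \<le> n \<Longrightarrow> Rn_set m \<subseteq> Rn_set n"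
  by (auto simp: Rn_set_def)

lemma Hausdorff_space_Rn: "Hausdorff_space (Rn n)"
  unfolding Rn_eq by (intro Hausdorff_space_subtopology Hausdorff_space_euclidean_t2)

lemma continuous_map_into_Rn:
  "continuous_map X (Rn n) f \<longleftrightarrow>
     f \<in> topspace X \<rightarrow> Rn_set n \<and> (\<forall>j. continuous_map X euclideanreal (\<lambda>x. f x j))"
  unfolding Rn_def continuous_map_in_subtopology continuous_map_componentwise_UNIV
  by auto

lemma continuous_map_Rn_component: "continuous_map (Rn n) euclideanreal (\<lambda>x. x j)"
  using continuous_map_into_Rn[of "Rn n" n "\<lambda>x. x"] by simp

lemma continuous_map_Bconf_Rn: "m \<le> n \<Longrightarrow> continuous_map (Bconf (Rn m) k) (Bconf (Rn n) k) id"
  unfolding Rn_def by (intro continuous_map_Bconf_subtopology Rn_set_mono)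

lemma continuous_map_Bconf_Rn_euclidean: "continuous_map (Bconf (Rn m) k) (Bconf euclidean k) id"
  using continuous_map_Bconf_subtopology[of "Rn_set m" UNIV euclidean k] by (simp add: Rn_eq)

definition Rn_trunc :: "nat \<Rightarrow> (nat \<Rightarrow> real) \<Rightarrow> nat \<Rightarrow> real" where
  "Rn_trunc n x = (\<lambda>j. if j < n then x j else 0)"

lemma continuous_map_Rn_trunc: "continuous_map (Rn m) (Rn n) (Rn_trunc n)"
  using continuous_map_Rn_component[of m]
  by (auto simp: continuous_map_into_Rn Rn_trunc_def Rn_set_def)

lemma Rn_trunc_id: "x \<in> Rn_set n \<Longrightarrow> Rn_trunc n x = x"
  by (auto simp: Rn_trunc_def Rn_set_def)

text \<open>The point \<open>(x, i)\<close> of R^(n+1). The coordinates of R^n have indices below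
  \<open>n\<close>, so index \<open>n\<close> is the extra dimension, and the label \<open>i\<close>
  becomes a height.\<close>

definition Rn_raise :: "nat \<Rightarrow> (nat \<Rightarrow> real) \<Rightarrow> nat \<Rightarrow> nat \<Rightarrow> real" where
  "Rn_raise n x i = (\<lambda>j. if j < n then x j else if j = n then real i else 0)"

definition straight_conf ::
    "nat \<Rightarrow> ('x \<Rightarrow> nat \<Rightarrow> nat \<Rightarrow> real) \<Rightarrow> ('x \<Rightarrow> nat \<Rightarrow> nat \<Rightarrow> real) \<Rightarrow> real \<times> 'x \<Rightarrow> (nat \<Rightarrow> real) set" where
  "straight_conf k a b = (\<lambda>(t,x). (\<lambda>i j. (1 - t) * a x i j + t * b x i j) ` {..<k})"

text \<open>The segments are followed in the ordered configuration space, where \<open>inj\<close>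
  rules out collisions, and the ordering is forgotten afterwards.\<close>

lemma continuous_map_straight_conf:
  assumes a: "\<And>i. i < k \<Longrightarrow> continuous_map X (Rn n) (\<lambda>x. a x i)"
    and b: "\<And>i. i < k \<Longrightarrow> continuous_map X (Rn n) (\<lambda>x. b x i)"
    and inj: "\<And>t x. t \<in> {0..1} \<Longrightarrow> x \<in> topspace X \<Longrightarrow>
      inj_on (\<lambda>i j. (1 - t) * a x i j + t * b x i j) {..<k}"
  shows "continuous_map (prod_topology (top_of_set {0..1}) X) (Bconf (Rn n) k) (straight_conf k a b)"
proof -
  define g where "g z = restrict (\<lambda>i j. (1 - fst z) * a (snd z) i j + fst z * b (snd z) i j) {..<k}" for z
  let ?P = "prod_topology (top_of_set {0..1::real}) X"
  have fst: "continuous_map ?P euclideanreal fst"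
    using continuous_map_fst[of "top_of_set {0..1::real}" X] by (simp add: continuous_map_in_subtopology)
  have "continuous_map ?P euclideanreal (\<lambda>z. (1 - fst z) * a (snd z) i j + fst z * b (snd z) i j)"
    if "i < k" for i j
  proof -
    have "continuous_map ?P euclideanreal (\<lambda>z. a (snd z) i j)"
      "continuous_map ?P euclideanreal (\<lambda>z. b (snd z) i j)"
      using continuous_map_compose[OF continuous_map_snd, of X euclideanreal "\<lambda>x. a x i j"]
        continuous_map_compose[OF continuous_map_snd, of X euclideanreal "\<lambda>x. b x i j"]
        a[OF that] b[OF that]
      by (auto simp: o_def continuous_map_into_Rn)
    then show ?thesis
      using fst by (intro continuous_intros)
  qed
  moreover have ab: "a x i \<in> Rn_set n" "b x i \<in> Rn_set n" if "x \<in> topspace X" "i < k" for x i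
    using a[OF that(2)] b[OF that(2)] that(1) by (auto simp: continuous_map_into_Rn)
  moreover have "(\<lambda>j. (1 - t) * a x i j + t * b x i j) \<in> Rn_set n" if "x \<in> topspace X" "i < k" for t x i
    using ab[OF that] by (simp add: Rn_set_def)
  ultimately have "continuous_map ?P (Fconf (Rn n) k) g"
    using inj by (auto simp: continuous_map_into_Fconf continuous_map_into_Rn topspace_Fconf g_def)
  from continuous_map_compose[OF this quotient_imp_continuous_map[OF quotient_map_conf_quot]]
  show ?thesis
    by (simp add: o_def g_def straight_conf_def case_prod_unfold)
qed

context
  fixes n k U s
  assumes U: "openin (Bconf (Rn n) k) U"
    and s: "continuous_map (subtopology (Bconf (Rn n) k) U) (Fconf (Rn n) k) s"
    and sq: "\<And>x. x \<in> U \<Longrightarrow> conf_quot k (s x) = x"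
begin

text \<open>The homotopies move the points \<open>x\<^sub>i\<close> of an ordered configuration along segments, first to
  \<open>(x\<^sub>i, i)\<close>, keeping the distinct truncations, and then to \<open>(0, i)\<close>, keeping the distinct heights.\<close>

private definition "\<sigma> = conf_pull_section k (Rn_trunc n) s"
private definition "H1 = straight_conf k \<sigma> (\<lambda>S i. Rn_raise n (\<sigma> S i) i)"
private definition "H2 = straight_conf k (\<lambda>S i. Rn_raise n (\<sigma> S i) i) (\<lambda>S. Rn_raise n (\<lambda>_. 0))"

private lemma continuous_map_H:
  assumes N: "n < N"
  shows "continuous_map (prod_topology (top_of_set {0..1})
      (subtopology (Bconf (Rn N) k) (conf_over (Rn_trunc n) U))) (Bconf (Rn N) k) H1"
    and "continuous_map (prod_topology (top_of_set {0..1})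
      (subtopology (Bconf (Rn N) k) (conf_over (Rn_trunc n) U))) (Bconf (Rn N) k) H2"
proof -
  let ?X = "subtopology (Bconf (Rn N) k) (conf_over (Rn_trunc n) U)"
  have \<sigma>: "continuous_map ?X (Rn N) (\<lambda>S. \<sigma> S i)" if "i < k" for i
    using continuous_map_conf_pull_section[OF continuous_map_Rn_trunc U s sq Hausdorff_space_Rn] that
    by (simp add: continuous_map_into_Fconf \<sigma>_def)
  \<comment> \<open>The strict inequality \<open>n < N\<close> provides room for the coordinate with
    index \<open>n\<close>.\<close>
  have raise: "continuous_map ?X (Rn N) (\<lambda>S. Rn_raise n (\<sigma> S i) i)" if "i < k" for i
    using \<sigma>[OF that] N by (auto simp: continuous_map_into_Rn Rn_raise_def Rn_set_def)
  have const: "continuous_map ?X (Rn N) (\<lambda>S. Rn_raise n (\<lambda>_. 0) i)" for i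
    using N by (auto simp: continuous_map_into_Rn Rn_raise_def Rn_set_def)
  have \<sigma>inj: "inj_on (\<lambda>i. Rn_trunc n (\<sigma> S i)) {..<k}" if "S \<in> topspace ?X" for S
    using conf_pull_section_props(4)[OF continuous_map_Rn_trunc[of N] U s sq] that by (simp add: \<sigma>_def)
  show "continuous_map (prod_topology (top_of_set {0..1}) ?X) (Bconf (Rn N) k) H1"
    unfolding H1_def
  proof (rule continuous_map_straight_conf[OF \<sigma> raise])
    fix t S assume S: "S \<in> topspace ?X"
    have "Rn_trunc n (\<lambda>j. (1 - t) * \<sigma> S i j + t * Rn_raise n (\<sigma> S i) i j) = Rn_trunc n (\<sigma> S i)" for i
      by (auto simp: Rn_trunc_def Rn_raise_def algebra_simps)
    then show "inj_on (\<lambda>i j. (1 - t) * \<sigma> S i j + t * Rn_raise n (\<sigma> S i) i j) {..<k}"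
      using \<sigma>inj[OF S] by (metis (mono_tags, lifting) inj_on_def)
  qed
  show "continuous_map (prod_topology (top_of_set {0..1}) ?X) (Bconf (Rn N) k) H2"
    unfolding H2_def
  proof (rule continuous_map_straight_conf[OF raise const])
    fix t S
    have "(1 - t) * Rn_raise n (\<sigma> S i) i n + t * Rn_raise n (\<lambda>_. 0) i n = real i" for i
      by (simp add: Rn_raise_def algebra_simps)
    then show "inj_on (\<lambda>i j. (1 - t) * Rn_raise n (\<sigma> S i) i j + t * Rn_raise n (\<lambda>_. 0) i j) {..<k}"
      by (intro inj_onI) (metis of_nat_eq_iff)
  qed
qed

text \<open>Concatenates the two homotopies. Only continuity into \<open>T\<close> depends on the
  target, so it is a hypothesis; the pointwise facts hold at any stage containing the given
  configuration.\<close>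

private lemma contractible_if_continuous_H:
  assumes T: "topspace T \<subseteq> (\<Union>N. topspace (Bconf (Rn N) k))"
    and H: "continuous_map (prod_topology (top_of_set {0..1}) (subtopology T (conf_over (Rn_trunc n) U))) T H1"
      "continuous_map (prod_topology (top_of_set {0..1}) (subtopology T (conf_over (Rn_trunc n) U))) T H2"
  shows "\<exists>c. homotopic_with (\<lambda>_. True) (subtopology T (conf_over (Rn_trunc n) U)) T id (\<lambda>_. c)"
proof -
  let ?X = "subtopology T (conf_over (Rn_trunc n) U)"
  have "conf_quot k (\<sigma> S) = S" if S: "S \<in> topspace ?X" for S
  proof -
    obtain N where "S \<in> topspace (Bconf (Rn N) k)"
      using T S by auto
    then show ?thesis
      using conf_pull_section_props(1)[OF continuous_map_Rn_trunc[of N] U s sq] S by (simp add: \<sigma>_def)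
  qed
  \<comment> \<open>At time 0 the ordering \<open>\<sigma> S\<close> is merely forgotten, which
    returns \<open>S\<close>.\<close>
  then have "H1 (0,S) = S" if "S \<in> topspace ?X" for S
    using that by (simp add: H1_def straight_conf_def conf_quot_def)
  then have "homotopic_with (\<lambda>_. True) ?X T id (\<lambda>S. H1 (1,S))"
    using H(1) by (subst homotopic_with) auto
  moreover have "H1 (1,S) = H2 (0,S)" for S
    by (simp add: H1_def H2_def straight_conf_def)
  \<comment> \<open>The final configuration consists of the points \<open>(0, i)\<close> for
    \<open>i < k\<close>, whatever \<open>S\<close> was.\<close>
  then have "homotopic_with (\<lambda>_. True) ?X T (\<lambda>S. H1 (1,S)) (\<lambda>_. Rn_raise n (\<lambda>_. 0) ` {..<k})"
    using H(2) by (subst homotopic_with) (auto simp: H2_def straight_conf_def)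
  ultimately show ?thesis
    using homotopic_with_trans by blast
qed

text \<open>For finite \<open>r\<close> one stage above \<open>n\<close> is enough. For infinite
  \<open>r\<close> openness and continuity are checked on the stages of the colimit.\<close>

lemma conf_over_contractible:
  assumes r: "r \<ge> 1"
  shows "\<exists>c. homotopic_with (\<lambda>_. True) (subtopology (Btarget n r k) (conf_over (Rn_trunc n) U)) (Btarget n r k) id (\<lambda>_. c)"
    and "openin (Btarget n r k) (topspace (Btarget n r k) \<inter> conf_over (Rn_trunc n) U)"
proof -
  let ?C = "conf_over (Rn_trunc n) U"
  have op: "openin (Bconf (Rn N) k) (topspace (Bconf (Rn N) k) \<inter> ?C)" for N
    by (rule openin_conf_over[OF Hausdorff_space_Rn continuous_map_Rn_trunc U])
  have "(\<exists>c. homotopic_with (\<lambda>_. True) (subtopology (Btarget n r k) ?C) (Btarget n r k) id (\<lambda>_. c)) \<and>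
    openin (Btarget n r k) (topspace (Btarget n r k) \<inter> ?C)"
  proof (cases r)
    case (enat m)
    then have "n < n + m"
      using r by (simp add: one_enat_def)
    then show ?thesis
      using enat op contractible_if_continuous_H[of "Bconf (Rn (n + m)) k"] continuous_map_H[of "n + m"]
      by (auto simp: Btarget_def)
  next
    case infinity
    \<comment> \<open>The colimit lemma expects an open subset of the space, whereas
      \<open>conf_over\<close> is confined to no space; \<open>subtopology_restrict\<close> later
      undoes the intersection.\<close>
    define W where "W = topspace (Binf k) \<inter> ?C"
    have "W \<inter> topspace (Bconf (Rn N) k) = topspace (Bconf (Rn N) k) \<inter> ?C" for N
      by (auto simp: W_def Binf_def topspace_colim_top)
    then have W: "openin (Binf k) W"
      using op by (auto simp: Binf_def openin_colim_top W_def topspace_colim_top)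
    have "continuous_map (prod_topology (top_of_set {0..1}) (subtopology (Binf k) W)) (Binf k) H"
      if H: "\<And>N. n < N \<Longrightarrow> continuous_map (prod_topology (top_of_set {0..1})
        (subtopology (Bconf (Rn N) k) ?C)) (Bconf (Rn N) k) H" for H :: "real \<times> _ \<Rightarrow> _"
      unfolding Binf_def
    proof (rule continuous_map_prod_colim_top)
      have "compact_space (top_of_set {0..1::real})"
        by (simp add: compact_space_subtopology)
      then show "neighbourhood_base_of (compactin (top_of_set {0..1::real})) (top_of_set {0..1})"
        by (intro locally_compact_imp_neighbourhood_base compact_imp_locally_compact_space
            compact_Hausdorff_imp_regular_space Hausdorff_space_subtopology Hausdorff_space_euclidean)
      show "openin (colim_top (\<lambda>m. Bconf (Rn m) k)) W"
        using W by (simp add: Binf_def)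
      fix m
      \<comment> \<open>A stage \<open>m \<le> n\<close> has no extra dimension, so it is first
        included into a stage beyond \<open>n\<close>, where the homotopy is defined and
        continuous.\<close>
      define N where "N = max m (Suc n)"
      have "continuous_map (subtopology (Bconf (Rn m) k) W) (subtopology (Bconf (Rn N) k) ?C) id"
        using continuous_map_from_subtopology[OF continuous_map_Bconf_Rn[of m N k]]
        by (auto simp: continuous_map_in_subtopology N_def W_def)
      then have "continuous_map (prod_topology (top_of_set {0..1::real}) (subtopology (Bconf (Rn m) k) W))
          (prod_topology (top_of_set {0..1}) (subtopology (Bconf (Rn N) k) ?C)) id"
        using continuous_map_prod_top[of "top_of_set {0..1::real}" "subtopology (Bconf (Rn m) k) W"
            "top_of_set {0..1::real}" "subtopology (Bconf (Rn N) k) ?C" id id]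
        by (simp add: id_def)
      from continuous_map_compose[OF continuous_map_compose[OF this H[of N]]
          continuous_map_into_colim_top[of "\<lambda>m. Bconf (Rn m) k" N]]
      show "continuous_map (prod_topology (top_of_set {0..1}) (subtopology (Bconf (Rn m) k) W))
          (colim_top (\<lambda>m. Bconf (Rn m) k)) H"
        by (simp add: N_def)
    qed
    then have "\<exists>c. homotopic_with (\<lambda>_. True) (subtopology (Binf k) ?C) (Binf k) id (\<lambda>_. c)"
      using continuous_map_H unfolding W_def subtopology_restrict
      by (intro contractible_if_continuous_H) (auto simp: Binf_def topspace_colim_top)
    then show ?thesis
      using W infinity by (simp add: Btarget_def W_def)
  qed
  then show "\<exists>c. homotopic_with (\<lambda>_. True) (subtopology (Btarget n r k) ?C) (Btarget n r k) id (\<lambda>_. c)"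
    and "openin (Btarget n r k) (topspace (Btarget n r k) \<inter> ?C)"
    by auto
qed

end

section \<open>Comparison of the three invariants\<close>

lemma continuous_map_Bconf_Btarget: "continuous_map (Bconf (Rn n) k) (Btarget n r k) id"
  using continuous_map_Bconf_Rn continuous_map_into_colim_top[of "\<lambda>m. Bconf (Rn m) k" n]
  by (cases r) (auto simp: Btarget_def Binf_def)

lemma continuous_map_Btarget_euclidean: "continuous_map (Btarget n r k) (Bconf euclidean k) id"
  by (cases r) (auto simp: Btarget_def Binf_def continuous_map_Bconf_Rn_euclidean
      intro: continuous_map_from_colim_top)

lemma section_if_nullhomotopic:
  assumes U: "openin (Bconf (Rn n) k) U"
    and null: "homotopic_with (\<lambda>_. True) (subtopology (Bconf (Rn n) k) U) (Btarget n r k) id (\<lambda>_. c)"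
  shows "\<exists>s. continuous_map (subtopology (Bconf (Rn n) k) U) (Fconf (Rn n) k) s \<and> (\<forall>x\<in>U. conf_quot k (s x) = x)"
proof (cases "U = {}")
  case True
  then show ?thesis by (auto simp: continuous_map)
next
  case False
  let ?X = "subtopology (Bconf (Rn n) k) U"
  have topX: "topspace ?X = U"
    using openin_subset[OF U] by auto
  have "homotopic_with (\<lambda>_. True) ?X (Bconf euclidean k) (\<lambda>_. c) id"
    using homotopic_with_compose_continuous_map_left[OF homotopic_with_symD[OF null]
        continuous_map_Btarget_euclidean, of "\<lambda>_. True"]
    by (simp add: o_def id_def)
  then obtain h :: "real \<times> _ \<Rightarrow> _"
    where h: "continuous_map (prod_topology (top_of_set {0..1}) ?X) (Bconf euclidean k) h"
    and h0: "\<And>x. h (0,x) = c" and h1: "\<And>x. h (1,x) = x"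
    unfolding homotopic_with_def id_def by blast
  \<comment> \<open>A point of \<open>U\<close> shows that \<open>c = h (0,x)\<close> is a genuine
    configuration, which therefore has an ordering \<open>c0\<close> to start the lift. Over an
    empty \<open>U\<close> the constant could be anything, hence the case split.\<close>
  obtain x where x: "x \<in> U"
    using False by blast
  have "h (0,x) \<in> topspace (Bconf euclidean k)"
    using continuous_map_funspace[OF h] x topX by (auto simp: Pi_iff)
  then have "c \<in> conf_quot k ` topspace (Fconf euclidean k)"
    using quotient_map_conf_quot[of "euclidean :: (nat \<Rightarrow> real) topology" k] by (simp add: quotient_map_def h0)
  then obtain c0 where c0: "c0 \<in> topspace (Fconf euclidean k)" "conf_quot k c0 = c"
    by blast
  obtain g where g: "continuous_map ?X (Fconf euclidean k) g"
    and gq: "\<And>x. x \<in> U \<Longrightarrow> conf_quot k (g x) = x"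
  proof (rule conf_homotopy_lifting[OF h, of "\<lambda>_. c0"])
    show "continuous_map ?X (Fconf euclidean k) (\<lambda>_. c0)"
      using c0(1) by simp
  qed (unfold topX h0 h1, use c0(2) that in auto)
  \<comment> \<open>Although the homotopy may leave R^n, its lift ends in an ordering of
    \<open>x\<close> itself, whose points lie in R^n.\<close>
  have mem: "g x i \<in> Rn_set n" if "x \<in> U" "i < k" for x i
  proof -
    have "x \<subseteq> Rn_set n"
      using that(1) openin_subset[OF U] by (auto simp: topspace_Bconf)
    then show ?thesis
      using gq[OF that(1)] that(2) by (auto simp: conf_quot_def)
  qed
  then have "continuous_map ?X (Fconf (Rn n) k) g"
    using g unfolding continuous_map_into_Fconf topX
    by (auto simp: topspace_Fconf Rn_eq continuous_map_in_subtopology topX PiE_iff Pi_iff)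
  then show ?thesis
    using gq by blast
qed

theorem theorem1:
  fixes n k :: nat and r :: enat
  assumes "n \<ge> 1" and "k \<ge> 1" and "r \<ge> 1"
  shows "secat (Fconf (Rn n) k) (Bconf (Rn n) k) (conf_quot k)
           = cat_map (Bconf (Rn n) k) (Btarget n r k) id
       \<and> cat_map (Bconf (Rn n) k) (Btarget n r k) id
           = subspace_cat (Btarget n r k) (topspace (Bconf (Rn n) k))"
proof -
  \<comment> \<open>Each invariant is an infimum over the admissible sizes \<open>m\<close> of
    covers. The cycle \<open>Cat\<close> to \<open>Secat\<close> to \<open>Sub\<close> to
    \<open>Cat\<close>, for each \<open>m\<close>, makes the three index sets equal, which includes
    the case of the value infinity.\<close>
  define B where "B = Bconf (Rn n) k"
  define T where "T = Btarget n r k"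
  define sec where "sec U \<longleftrightarrow> (\<exists>s. continuous_map (subtopology B U) (Fconf (Rn n) k) s \<and>
      (\<forall>x\<in>U. conf_quot k (s x) = x))" for U
  define null where "null X U \<longleftrightarrow> (\<exists>c. homotopic_with (\<lambda>_. True) (subtopology X U) T id (\<lambda>_. c))" for X U
  define Secat where "Secat m \<longleftrightarrow> (\<exists>U. (\<forall>i\<le>m. openin B (U i) \<and> sec (U i)) \<and> topspace B \<subseteq> (\<Union>i\<le>m. U i))"
    for m :: nat
  define Cat where "Cat m \<longleftrightarrow> (\<exists>U. (\<forall>i\<le>m. openin B (U i) \<and> null B (U i)) \<and> topspace B \<subseteq> (\<Union>i\<le>m. U i))"
    for m :: nat
  define Sub where "Sub m \<longleftrightarrow> (\<exists>U. (\<forall>i\<le>m. openin T (U i) \<and> null T (U i)) \<and> topspace B \<subseteq> (\<Union>i\<le>m. U i))"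
    for m :: nat
  have BT: "continuous_map B T id"
    unfolding B_def T_def by (rule continuous_map_Bconf_Btarget)
  have "Secat m" if Cat: "Cat m" for m
    using Cat section_if_nullhomotopic[of n k _ r]
    unfolding Cat_def Secat_def sec_def null_def B_def T_def by meson
  moreover have "Cat m" if Sub: "Sub m" for m
  proof -
    obtain U where U: "\<And>i. i \<le> m \<Longrightarrow> openin T (U i) \<and> null T (U i)" "topspace B \<subseteq> (\<Union>i\<le>m. U i)"
      using Sub unfolding Sub_def by blast
    \<comment> \<open>Both openness and nullhomotopy pull back along the continuous inclusion of
      \<open>B\<close> into \<open>T\<close>.\<close>
    have "openin B {x \<in> topspace B. x \<in> U i}" if "i \<le> m" for i
      using openin_continuous_map_preimage[OF BT, of "U i"] U(1)[OF that] by simp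
    moreover have "null B {x \<in> topspace B. x \<in> U i}" if i: "i \<le> m" for i
    proof -
      obtain c where c: "homotopic_with (\<lambda>_. True) (subtopology T (U i)) T id (\<lambda>_. c)"
        using U(1)[OF i] unfolding null_def by blast
      have "continuous_map (subtopology B {x \<in> topspace B. x \<in> U i}) (subtopology T (U i)) id"
        using continuous_map_from_subtopology[OF BT] by (auto simp: continuous_map_in_subtopology)
      from homotopic_with_compose_continuous_map_right[OF c this, of "\<lambda>_. True"]
      show ?thesis
        unfolding null_def by (auto simp: o_def id_def)
    qed
    moreover have "topspace B \<subseteq> (\<Union>i\<le>m. {x \<in> topspace B. x \<in> U i})"
      using U(2) by blast
    ultimately show ?thesis
      unfolding Cat_def by (intro exI[of _ "\<lambda>i. {x \<in> topspace B. x \<in> U i}"]) blast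
  qed
  moreover have "Sub m" if Secat: "Secat m" for m
  proof -
    obtain U where U: "\<And>i. i \<le> m \<Longrightarrow> openin B (U i) \<and> sec (U i)" "topspace B \<subseteq> (\<Union>i\<le>m. U i)"
      using Secat unfolding Secat_def by blast
    define W where "W i = topspace T \<inter> conf_over (Rn_trunc n) (U i)" for i
    have "openin T (W i) \<and> null T (W i)" if i: "i \<le> m" for i
    proof -
      obtain s where "continuous_map (subtopology B (U i)) (Fconf (Rn n) k) s"
        "\<And>x. x \<in> U i \<Longrightarrow> conf_quot k (s x) = x"
        using U(1)[OF i] unfolding sec_def by blast
      then show ?thesis
        using conf_over_contractible[of n k "U i" s r] U(1)[OF i] \<open>r \<ge> 1\<close>
        unfolding null_def W_def T_def B_def by (simp add: subtopology_restrict)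
    qed
    moreover have "topspace B \<subseteq> (\<Union>i\<le>m. W i)"
    proof
      fix S assume S: "S \<in> topspace B"
      then obtain i where i: "i \<le> m" "S \<in> U i"
        using U(2) by auto
      have "S \<in> topspace T"
        using continuous_map_funspace[OF BT] S by (auto simp: Pi_iff)
      \<comment> \<open>Truncation fixes every configuration in R^n, so \<open>W i\<close> contains
        \<open>U i\<close> and the enlarged sets still cover.\<close>
      moreover have "Rn_trunc n x = x" if "x \<in> S" for x
        using S that Rn_trunc_id by (auto simp: B_def topspace_Bconf)
      then have "Rn_trunc n ` S = S" "inj_on (Rn_trunc n) S"
        by (auto simp: inj_on_def)
      ultimately show "S \<in> (\<Union>i\<le>m. W i)"
        using i by (auto simp: W_def conf_over_def)
    qed
    ultimately show ?thesis
      unfolding Sub_def by blast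
  qed
  ultimately have "Collect Secat = Collect Cat" "Collect Cat = Collect Sub"
    by blast+
  moreover have "secat (Fconf (Rn n) k) B (conf_quot k) = (INF m\<in>Collect Secat. enat m)"
    unfolding secat_def Secat_def sec_def by simp
  moreover have "cat_map B T id = (INF m\<in>Collect Cat. enat m)"
    unfolding cat_map_def Cat_def null_def by simp
  moreover have "subspace_cat T (topspace B) = (INF m\<in>Collect Sub. enat m)"
    unfolding subspace_cat_def Sub_def null_def by simp
  ultimately show ?thesis
    unfolding B_def T_def by simp
qed

end
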